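(* (1) The family $\{\Pi_l\}_{l\in\mathcal{L}yn\,Y}$ is a basis of the $\mathbf{k}$-module $\mathcal{P}$ of primitive polynomials for $\Delta_\star$. (2) The family $\{\Pi_w\}_{w\in Y^*}$ is a basis of the $\mathbf{k}$-module $\mathbf{k}\langle Y\rangle$. (3) The family $\{\Sigma_w\}_{w\in Y^*}$ freely generates the $q$-stuffle algebra $(\mathbf{k}\langle Y\rangle,\star)$ as a $\mathbf{k}$-module, i.e. it is a linear basis of it. (4) The family $\{\Sigma_l\}_{l\in\mathcal{L}yn\,Y}$ is a transcendence basis of $(\mathbf{k}\langle Y\rangle,\star)$.
   Context: Let $\mathbf{k}$ be a commutative unital $\mathbb{Q}$-algebra and $q\in\mathbf{k}$. Let $Y=\{y_s\}_{s\ge1}$ be an alphabet totally ordered by $y_1>y_2>\cdots$; $Y^*$ is the set of words, ordered lexicographically (a proper prefix being smaller), $1_{Y^*}$ the empty word, $Y^+=Y^*\setminus\{1_{Y^*}\}$, $\mathbf{k}\langle Y\rangle$ the noncommutative polynomials. $\langle P\mid w\rangle$ is the coefficient of the word $w$ in $P$, extended to a bilinear pairing for which words are orthonormal. The $q$-stuffle product $\star$ is the bilinear product on $\mathbf{k}\langle Y\rangle$ with $u\star 1_{Y^*}=1_{Y^*}\star u=u$ and $y_su\star y_tv=y_s(u\star y_tv)+y_t(y_su\star v)+q\,y_{s+t}(u\star v)$; it is commutative, associative and unital. Its dual coproduct is the concatenation-morphism $\Delta_\star$ with $\Delta_\star(y_s)=y_s\otimes1_{Y^*}+1_{Y^*}\otimes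 y_s+q\sum_{s_1+s_2=s,\ s_1,s_2\ge1}y_{s_1}\otimes y_{s_2}$, so $\Delta_\star P=\sum_{u,v}\langle P\mid u\star v\rangle u\otimes v$. $\mathcal{P}=\{P\in\mathbf{k}\langle Y\rangle\mid\Delta_\star P=P\otimes1_{Y^*}+1_{Y^*}\otimes P\}$. For $w\in Y^+$ set $\pi_1(w)=w+\sum_{k\ge2}\frac{(-1)^{k-1}}{k}\sum_{u_1,\dots,u_k\in Y^+}\langle w\mid u_1\star\cdots\star u_k\rangle\,u_1\cdots u_k$. $\mathcal{L}yn\,Y$ is the set of Lyndon words: nonempty words strictly smaller than each of their proper nonempty right factors. The standard factorization of a Lyndon word $l$ of length $\ge 2$ is $(s,r)$ with $l=sr$ and $r$ the longest proper right factor of $l$ that is Lyndon (then $s$ is Lyndon). Every word factors uniquely as $w=l_1^{i_1}\cdots l_k^{i_k}$ with $l_1>\cdots>l_k$ Lyndon. Define $\Pi_{y_k}=\pi_1(y_k)$; $\Pi_l=[\Pi_s,\Pi_r]$ (commutator) for $l$ Lyndon of length $\ge2$ with standard factorization $(s,r)$; $\Pi_w=\Pi_{l_1}^{i_1}\cdots\Pi_{l_k}^{i_k}$ for $w=l_1^{i_1}\cdots l_k^{i_k}$ with $l_1>\cdots>l_k$ Lyndon words and $i_1,\dots,i_k\ge1$ ($\Pi_{1_{Y^*}}=1$). $\{\Sigma_w\}_{w\in Y^*}$ is the family in $\mathbf{k}\langle Y\rangle$ dual to $\{\Pi_w\}$: $\langle\Sigma_v\mid\Pi_u\rangle=\delta_{u,v}$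 for all $u,v\in Y^*$ (it exists and is unique because $\{\Pi_w\}$ is homogeneous and unitriangular with respect to words in each weight, where the weight of $y_{i_1}\cdots y_{i_r}$ is $i_1+\cdots+i_r$, and there are finitely many words of each weight). A transcendence basis of a commutative algebra here means an algebraically independent family generating the algebra, i.e. the algebra is the polynomial algebra on that family. *)

theory Defs
  imports
    Complex_Main
    "HOL-Library.Poly_Mapping"
    "HOL-Library.List_Lexorder"
    "HOL-Library.Sublist"
    "HOL-Library.Product_Plus"
begin

section \<open>Coefficients, letters and words\<close>

class comm_rat_algebra_1 = comm_ring_1 +
  fixes scaleQ :: "rat \<Rightarrow> 'a \<Rightarrow> 'a" (infixr "*\<^sub>Q" 75)
  assumes scaleQ_add_right: "a *\<^sub>Q (x + y) = a *\<^sub>Q x + a *\<^sub>Q y"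
    and scaleQ_add_left: "(a + b) *\<^sub>Q x = a *\<^sub>Q x + b *\<^sub>Q x"
    and scaleQ_scaleQ: "a *\<^sub>Q b *\<^sub>Q x = (a * b) *\<^sub>Q x"
    and scaleQ_one: "1 *\<^sub>Q x = x"
    and mult_scaleQ_left: "(a *\<^sub>Q x) * y = a *\<^sub>Q (x * y)"

text \<open>The letter \<open>y\<^sub>s\<close> is \<open>letter s\<close>; it is meaningful for \<open>s \<ge> 1\<close> only.\<close>

typedef letter = "{s :: nat. 1 \<le> s}"
  morphisms index letter
  by auto

text \<open>The order on letters is reversed: \<open>y\<^sub>1 > y\<^sub>2 > \<dots>\<close>.\<close>

instantiation letter :: linorder
begin

definition less_eq_letter :: "letter \<Rightarrow> letter \<Rightarrow> bool" where
  "a \<le> b \<longleftrightarrow> index b \<le> index a"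

definition less_letter :: "letter \<Rightarrow> letter \<Rightarrow> bool" where
  "a < b \<longleftrightarrow> index b < index a"

instance
  by standard (auto simp: less_eq_letter_def less_letter_def index_inject)

end

text \<open>
  Words are lists of letters. The order on them is the one of
  \<^theory>\<open>HOL-Library.List_Lexorder\<close>, in which a proper prefix is smaller.
  The additive notation for concatenation makes \<open>letter list \<Rightarrow>\<^sub>0 'k\<close>, with its library
  multiplication, the ring of noncommutative polynomials.
\<close>

type_synonym lword = "letter list"

instantiation list :: (type) monoid_add
begin

definition zero_list :: "'a list" where
  "0 = []"

definition plus_list :: "'a list \<Rightarrow> 'a list \<Rightarrow> 'a list" where
  "xs + ys = xs @ ys"

instance
  by standard (auto simp: zero_list_def plus_list_def)

end

definition lyndon :: "lword \<Rightarrow> bool" where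
  "lyndon w \<longleftrightarrow> w \<noteq> [] \<and> (\<forall>v. strict_suffix v w \<and> v \<noteq> [] \<longrightarrow> w < v)"

text \<open>The standard factorization \<open>(s, r)\<close> of a word of length at least \<open>2\<close>.\<close>

definition std_right :: "lword \<Rightarrow> lword" where
  "std_right l = (ARG_MAX length r. strict_suffix r l \<and> lyndon r)"

definition std_left :: "lword \<Rightarrow> lword" where
  "std_left l = take (length l - length (std_right l)) l"

text \<open>
  The factorization \<open>w = l\<^sub>1\<^bsup>i\<^sub>1\<^esup> \<dots> l\<^sub>k\<^bsup>i\<^sub>k\<^esup>\<close> with \<open>l\<^sub>1 > \<dots> > l\<^sub>k\<close>,
  as the list of pairs \<open>(l\<^sub>j, i\<^sub>j)\<close>.
\<close>

definition lyndon_factorization :: "lword \<Rightarrow> (lword \<times> nat) list" where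
  "lyndon_factorization w = (THE ps.
     (\<forall>(l, i) \<in> set ps. lyndon l \<and> 1 \<le> i) \<and>
     sorted_wrt (\<lambda>l l'. l > l') (map fst ps) \<and>
     w = concat (map (\<lambda>(l, i). concat (replicate i l)) ps))"

lemma lyndon_singleton: "lyndon [a]"
  by (auto simp: lyndon_def strict_suffix_def suffix_Cons)

lemma std_right:
  assumes "2 \<le> length l"
  shows "strict_suffix (std_right l) l" "lyndon (std_right l)"
proof -
  from assms have "l \<noteq> []"
    by auto
  then obtain s a where "l = s @ [a]"
    by (cases l rule: rev_cases) auto
  with assms have "s \<noteq> []"
    by auto
  with \<open>l = s @ [a]\<close>
  have "strict_suffix [a] l \<and> lyndon [a]"
    by (auto simp: lyndon_singleton strict_suffix_def suffix_def)
  moreover have "\<forall>r. strict_suffix r l \<and> lyndon r \<longrightarrow> length r < length l"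
    by (simp add: strict_suffix_def suffix_length_less)
  ultimately have "strict_suffix (std_right l) l \<and> lyndon (std_right l)"
    unfolding std_right_def by (rule arg_max_natI)
  then show "strict_suffix (std_right l) l" "lyndon (std_right l)"
    by auto
qed

lemma std_left_append_std_right:
  assumes "2 \<le> length l"
  shows "std_left l @ std_right l = l"
proof -
  obtain s where "l = s @ std_right l"
    using std_right(1)[OF assms] by (auto simp: strict_suffix_def suffix_def)
  moreover from arg_cong[OF this, of length]
  have "length l = length s + length (std_right l)"
    unfolding length_append .
  then have "length l - length (std_right l) = length s"
    by arith
  ultimately have "std_left l = s"
    unfolding std_left_def by (metis append_eq_conv_conj)
  with \<open>l = s @ std_right l\<close> show ?thesis
    by (simp only:)
qed

lemma length_std_right:
  assumes "\<not> length l < 2"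
  shows "length (std_right l) < length l"
  using std_right(1)[of l] assms by (simp add: strict_suffix_def suffix_length_less)

lemma length_std_left:
  assumes "\<not> length l < 2"
  shows "length (std_left l) < length l"
proof -
  have "0 < length (std_right l)"
    using std_right(2)[of l] assms by (simp add: lyndon_def)
  moreover have "length (std_left l) + length (std_right l) = length l"
    unfolding length_append[symmetric] using std_left_append_std_right[of l] assms by simp
  ultimately show ?thesis
    by arith
qed

section \<open>Noncommutative polynomials\<close>

type_synonym 'k ncpoly = "lword \<Rightarrow>\<^sub>0 'k"

abbreviation coeff :: "('a \<Rightarrow>\<^sub>0 'k::zero) \<Rightarrow> 'a \<Rightarrow> 'k" where
  "coeff \<equiv> Poly_Mapping.lookup"

abbreviation supp :: "('a \<Rightarrow>\<^sub>0 'k::zero) \<Rightarrow> 'a set" where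
  "supp \<equiv> Poly_Mapping.keys"

definition scale :: "'k::comm_ring_1 \<Rightarrow> ('a \<Rightarrow>\<^sub>0 'k) \<Rightarrow> ('a \<Rightarrow>\<^sub>0 'k)" where
  "scale c P = Poly_Mapping.map ((*) c) P"

lemma coeff_scale: "coeff (scale c P) w = c * coeff P w"
  by (simp add: scale_def Poly_Mapping.map.rep_eq when_def)

interpretation poly: module scale
  by standard (auto intro!: poly_mapping_eqI simp: coeff_scale lookup_add algebra_simps)

abbreviation word_poly :: "'a \<Rightarrow> ('a \<Rightarrow>\<^sub>0 'k::comm_ring_1)" where
  "word_poly w \<equiv> Poly_Mapping.single w 1"

definition pairing :: "'k::comm_ring_1 ncpoly \<Rightarrow> 'k ncpoly \<Rightarrow> 'k" where
  "pairing P Q = (\<Sum>w\<in>supp P. coeff P w * coeff Q w)"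

definition is_basis :: "'i set \<Rightarrow> ('i \<Rightarrow> 'k::comm_ring_1 ncpoly) \<Rightarrow> 'k ncpoly set \<Rightarrow> bool" where
  "is_basis I f M \<longleftrightarrow> inj_on f I \<and> poly.independent (f ` I) \<and> poly.span (f ` I) = M"

section \<open>The \<open>q\<close>-stuffle product and its dual coproduct\<close>

fun stuffle_word :: "'k::comm_ring_1 \<Rightarrow> lword \<Rightarrow> lword \<Rightarrow> 'k ncpoly" where
  "stuffle_word q [] v = word_poly v"
| "stuffle_word q u [] = word_poly u"
| "stuffle_word q (a # u) (b # v) =
     word_poly [a] * stuffle_word q u (b # v) +
     word_poly [b] * stuffle_word q (a # u) v +
     scale q (word_poly [letter (index a + index b)] * stuffle_word q u v)"

definition stuffle :: "'k::comm_ring_1 \<Rightarrow> 'k ncpoly \<Rightarrow> 'k ncpoly \<Rightarrow> 'k ncpoly" where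
  "stuffle q P Q =
     (\<Sum>u\<in>supp P. \<Sum>v\<in>supp Q. scale (coeff P u * coeff Q v) (stuffle_word q u v))"

text \<open>
  The tensor square is the free module on pairs of words; its library multiplication
  concatenates componentwise.
\<close>

type_synonym 'k ncpoly2 = "(lword \<times> lword) \<Rightarrow>\<^sub>0 'k"

definition tensor :: "'k::comm_ring_1 ncpoly \<Rightarrow> 'k ncpoly \<Rightarrow> 'k ncpoly2" where
  "tensor P Q =
     (\<Sum>u\<in>supp P. \<Sum>v\<in>supp Q. Poly_Mapping.single (u, v) (coeff P u * coeff Q v))"

definition coproduct_letter :: "'k::comm_ring_1 \<Rightarrow> letter \<Rightarrow> 'k ncpoly2" where
  "coproduct_letter q a =
     tensor (word_poly [a]) 1 + tensor 1 (word_poly [a]) +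
     scale q (\<Sum>i = 1..<index a.
       tensor (word_poly [letter i]) (word_poly [letter (index a - i)]))"

definition coproduct :: "'k::comm_ring_1 \<Rightarrow> 'k ncpoly \<Rightarrow> 'k ncpoly2" where
  "coproduct q P =
     (\<Sum>w\<in>supp P. scale (coeff P w) (prod_list (map (coproduct_letter q) w)))"

definition primitives :: "'k::comm_ring_1 \<Rightarrow> 'k ncpoly set" where
  "primitives q = {P. coproduct q P = tensor P 1 + tensor 1 P}"

section \<open>The families \<open>\<Pi>\<close> and \<open>\<Sigma>\<close>\<close>

text \<open>
  The list \<open>us\<close> is \<open>[u\<^sub>1, \<dots>, u\<^sub>k]\<close>. The sum has finite support, as required by
  \<^const>\<open>Sum_any\<close>: all words of \<open>u\<^sub>1 \<star> \<dots> \<star> u\<^sub>k\<close> have the same weight as \<open>u\<^sub>1 \<dots> u\<^sub>k\<close>.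
\<close>

definition pi1 :: "'k::comm_rat_algebra_1 \<Rightarrow> lword \<Rightarrow> 'k ncpoly" where
  "pi1 q w = word_poly w +
     Sum_any (\<lambda>us :: lword list.
       (let k = length us;
            c = coeff (foldr (\<lambda>u. stuffle q (word_poly u)) us 1) w
        in scale (((-1) ^ (k - 1) / of_nat k) *\<^sub>Q c) (word_poly (concat us)))
       when 2 \<le> length us \<and> [] \<notin> set us)"

text \<open>This is meant for Lyndon words only.\<close>

function Pi_lyndon :: "'k::comm_rat_algebra_1 \<Rightarrow> lword \<Rightarrow> 'k ncpoly" where
  "Pi_lyndon q l =
     (if length l < 2 then pi1 q l
      else Pi_lyndon q (std_left l) * Pi_lyndon q (std_right l) -
           Pi_lyndon q (std_right l) * Pi_lyndon q (std_left l))"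
  by auto

termination
  by (relation "Wellfounded.measure (\<lambda>(q, l). length l)")
    (auto simp: length_std_left length_std_right)

declare Pi_lyndon.simps [simp del]

definition Pi_family :: "'k::comm_rat_algebra_1 \<Rightarrow> lword \<Rightarrow> 'k ncpoly" where
  "Pi_family q w = prod_list (map (\<lambda>(l, i). Pi_lyndon q l ^ i) (lyndon_factorization w))"

definition Sigma_family :: "'k::comm_rat_algebra_1 \<Rightarrow> lword \<Rightarrow> 'k ncpoly" where
  "Sigma_family q = (THE S. \<forall>u v. pairing (S v) (Pi_family q u) = (if u = v then 1 else 0))"

section \<open>Transcendence bases of the \<open>q\<close>-stuffle algebra\<close>

definition stuffle_power :: "'k::comm_ring_1 \<Rightarrow> 'k ncpoly \<Rightarrow> nat \<Rightarrow> 'k ncpoly" where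
  "stuffle_power q P n = (stuffle q P ^^ n) 1"

text \<open>
  Commutative polynomials in variables indexed by \<open>'i\<close> have type \<open>('i \<Rightarrow>\<^sub>0 nat) \<Rightarrow>\<^sub>0 'k\<close>; they are
  evaluated at a family \<open>f\<close> with respect to the (commutative) product \<^term>\<open>stuffle q\<close>.
\<close>

definition stuffle_monomial ::
    "'k::comm_ring_1 \<Rightarrow> ('i \<Rightarrow> 'k ncpoly) \<Rightarrow> ('i \<Rightarrow>\<^sub>0 nat) \<Rightarrow> 'k ncpoly" where
  "stuffle_monomial q f m =
     comm_monoid_set.F (stuffle q) 1 (\<lambda>i. stuffle_power q (f i) (coeff m i)) (supp m)"

definition stuffle_eval ::
    "'k::comm_ring_1 \<Rightarrow> ('i \<Rightarrow> 'k ncpoly) \<Rightarrow> (('i \<Rightarrow>\<^sub>0 nat) \<Rightarrow>\<^sub>0 'k) \<Rightarrow> 'k ncpoly" where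
  "stuffle_eval q f p = (\<Sum>m\<in>supp p. scale (coeff p m) (stuffle_monomial q f m))"

definition stuffle_alg_independent ::
    "'k::comm_ring_1 \<Rightarrow> 'i set \<Rightarrow> ('i \<Rightarrow> 'k ncpoly) \<Rightarrow> bool" where
  "stuffle_alg_independent q I f \<longleftrightarrow>
     (\<forall>p :: ('i \<Rightarrow>\<^sub>0 nat) \<Rightarrow>\<^sub>0 'k.
        (\<forall>m\<in>supp p. supp m \<subseteq> I) \<and> stuffle_eval q f p = 0 \<longrightarrow> p = 0)"

definition stuffle_subalgebra :: "'k::comm_ring_1 \<Rightarrow> 'k ncpoly set \<Rightarrow> bool" where
  "stuffle_subalgebra q A \<longleftrightarrow>
     poly.subspace A \<and> 1 \<in> A \<and> (\<forall>P\<in>A. \<forall>Q\<in>A. stuffle q P Q \<in> A)"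

definition stuffle_transcendence_basis ::
    "'k::comm_ring_1 \<Rightarrow> 'i set \<Rightarrow> ('i \<Rightarrow> 'k ncpoly) \<Rightarrow> bool" where
  "stuffle_transcendence_basis q I f \<longleftrightarrow>
     stuffle_alg_independent q I f \<and> stuffle_subalgebra q hull (f ` I) = UNIV"

end

theory Submission
  imports Defs "HOL-Library.Multiset"
begin

text \<open>
  Every \<open>\<Pi>\<^sub>w\<close> is \<open>w\<close> plus lexicographically larger words of the same weight, so the
  \<open>\<Pi>\<^sub>w\<close> and their dual family are bases. The polynomials \<open>\<pi>\<^sub>1(y\<^sub>k)\<close> are primitive because
  their coefficients are those of \<open>log (1 + q x) / q\<close>, and primitivity passes to commutators.
  Hence \<open>\<Delta> \<Pi>\<^sub>w\<close> is the sum of \<open>\<Pi>\<^sub>u \<otimes> \<Pi>\<^sub>v\<close> over all ways of distributing the Lyndon factors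
  of \<open>w\<close> between \<open>u\<close> and \<open>v\<close>. Dually, \<open>\<Sigma>\<^sub>u \<star> \<Sigma>\<^sub>v\<close> is a positive integer multiple of \<open>\<Sigma>\<^sub>w\<close>,
  where the multiset of Lyndon factors of \<open>w\<close> is the sum of those of \<open>u\<close> and \<open>v\<close>. As positive
  integers are invertible, the \<open>\<star>\<close>-monomials in the \<open>\<Sigma>\<^sub>l\<close> are, up to units, the basis
  \<open>\<Sigma>\<^sub>w\<close>; and pairing a primitive polynomial with such a proper product gives zero, so only
  the \<open>\<Pi>\<^sub>l\<close> occur in it.
\<close>

text \<open>The coefficient ring may have zero divisors, and \<open>q\<close> may be one of them or
  \<open>0\<close>, so neither dimension counts nor division by \<open>q\<close> are available.
  Bases therefore come from inverting unitriangular matrices explicitly, within each weight, where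
  finitely many words occur; the same finiteness makes the dual family consist of polynomials. The
  series log (1 + q x) / q has the coefficients (-1)^(r-1) q^(r-1) / r, in which \<open>q\<close> is
  no longer divided by. Since \<open>\<Pi>\<close> is built from \<open>pi1\<close> at letters
  alone, these polynomials can be computed outright: a letter occurs in a product of k nonempty
  words only if each of them is a letter, and then by merging all of them, which costs q^(k-1). The
  description of the primitive polynomials replaces a structure theorem for Hopf algebras by a
  computation in the dual algebra.\<close>

lemma zero_list_eq_Nil [simp]: "(0 :: 'a list) = []"
  by (fact zero_list_def)

lemma plus_list_eq_append [simp]: "(xs :: 'a list) + ys = xs @ ys"
  by (fact plus_list_def)

lemma zero_prod_eq [simp]: "(0 :: 'a::zero \<times> 'b::zero) = (0, 0)"
  by (fact zero_prod_def)

lemma word_poly_Nil [simp]: "word_poly [] = 1"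
  using single_one[where 'a = "'a list"] by simp

lemma word_poly_pair_Nil [simp]: "word_poly ([], []) = 1"
  using single_one[where 'a = "'a list \<times> 'b list"] by simp

lemma coeff_one_list: "coeff 1 w = (if w = [] then 1 else 0)"
  by (simp add: lookup_one when_def)

section \<open>Linear extensions\<close>

lemma scale_single [simp]: "scale c (Poly_Mapping.single w d) = Poly_Mapping.single w (c * d)"
  by (rule poly_mapping_eqI) (simp add: coeff_scale lookup_single when_def)

lemma poly_eq_sum: "P = (\<Sum>w\<in>supp P. scale (coeff P w) (word_poly w))"
  by (rule poly_mapping_eqI)
    (simp add: lookup_sum coeff_scale lookup_single when_def if_distrib sum.delta' in_keys_iff
      cong: if_cong)

text \<open>Zero needs no case of its own, being 0 times a word. An identity that is linear in each
  argument is thereby reduced to words, one argument at a time.\<close>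

lemma poly_induct [case_names word add scale]:
  fixes P :: "'a \<Rightarrow>\<^sub>0 'k::comm_ring_1"
  assumes word: "\<And>w. A (word_poly w)"
    and add: "\<And>P Q. A P \<Longrightarrow> A Q \<Longrightarrow> A (P + Q)"
    and scale: "\<And>c P. A P \<Longrightarrow> A (scale c P)"
  shows "A P"
proof -
  have A0: "A 0"
    using scale[OF word, of 0 undefined] by simp
  have "A (\<Sum>w\<in>I. scale (coeff P w) (word_poly w))" if "finite I" for I
    using that by induct (use A0 word add scale in \<open>auto simp del: scale_single\<close>)
  then show ?thesis
    by (subst poly_eq_sum) auto
qed

lemma scale_mult_left [simp]:
  fixes P :: "'a::monoid_add \<Rightarrow>\<^sub>0 'k::comm_ring_1"
  shows "scale c P * Q = scale c (P * Q)"
  by (simp add: scale_def mult_map_scale_conv_mult mult.assoc)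

lemma scale_mult_right [simp]:
  fixes P :: "'a::monoid_add \<Rightarrow>\<^sub>0 'k::comm_ring_1"
  shows "P * scale c Q = scale c (P * Q)"
proof (induct P rule: poly_induct)
  case (word w)
  show ?case
    by (induct Q arbitrary: c rule: poly_induct)
      (simp_all add: mult_single distrib_left poly.scale_right_distrib mult.commute)
qed (simp_all add: distrib_right poly.scale_right_distrib mult.commute)

lemma supp_scale: "supp (scale c P) \<subseteq> supp P"
  by (auto simp: in_keys_iff coeff_scale)

text \<open>The coefficients form one finitely supported map, so a linear relation is a single
  object and \<open>lincomb f\<close> is linear in it. With words as indices this is the linear
  extension of \<open>f\<close>, the form in which product, tensor and coproduct are
  handled.\<close>

definition lincomb :: "('i \<Rightarrow> ('a \<Rightarrow>\<^sub>0 'k::comm_ring_1)) \<Rightarrow> ('i \<Rightarrow>\<^sub>0 'k) \<Rightarrow> ('a \<Rightarrow>\<^sub>0 'k)" where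
  "lincomb f c = (\<Sum>i\<in>supp c. scale (coeff c i) (f i))"

lemma lincomb_superset:
  assumes "finite I" "supp c \<subseteq> I"
  shows "lincomb f c = (\<Sum>i\<in>I. scale (coeff c i) (f i))"
  unfolding lincomb_def using assms
  by (intro sum.mono_neutral_left) (auto simp: in_keys_iff)

lemma lincomb_zero [simp]: "lincomb f 0 = 0"
  by (simp add: lincomb_def)

lemma lincomb_add [simp]: "lincomb f (P + Q) = lincomb f P + lincomb f Q"
  using keys_add[of P Q]
  by (simp add: lincomb_superset[of "supp P \<union> supp Q"] lookup_add poly.scale_left_distrib
      sum.distrib)

lemma lincomb_scale [simp]: "lincomb f (scale c P) = scale c (lincomb f P)"
  using supp_scale[of c P]
  by (simp add: lincomb_superset[of "supp P"] coeff_scale poly.scale_sum_right)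

lemma lincomb_single [simp]: "lincomb f (Poly_Mapping.single i c) = scale c (f i)"
  by (simp add: lincomb_def)

lemma lincomb_one [simp]: "lincomb f (1 :: 'a list \<Rightarrow>\<^sub>0 'k) = (f [] :: _ \<Rightarrow>\<^sub>0 'k::comm_ring_1)"
  by (simp add: lincomb_def coeff_one_list)

lemma lincomb_diff [simp]: "lincomb f (P - Q) = lincomb f P - lincomb f Q"
  by (metis add_diff_cancel_right' diff_add_cancel lincomb_add)

lemma lincomb_sum [simp]: "lincomb f (sum g A) = (\<Sum>a\<in>A. lincomb f (g a))"
  by (induct A rule: infinite_finite_induct) simp_all

lemma coeff_lincomb: "coeff (lincomb f c) w = (\<Sum>i\<in>supp c. coeff c i * coeff (f i) w)"
  by (simp add: lincomb_def lookup_sum coeff_scale)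

text \<open>The functional \<open>f\<close> need not have finite support, which goes beyond
  \<open>pairing\<close>: later it is a function of the length of a word.\<close>

definition ev :: "('a \<Rightarrow> 'k::comm_ring_1) \<Rightarrow> ('a \<Rightarrow>\<^sub>0 'k) \<Rightarrow> 'k" where
  "ev f P = (\<Sum>w\<in>supp P. coeff P w * f w)"

lemma ev_superset:
  assumes "finite I" "supp P \<subseteq> I"
  shows "ev f P = (\<Sum>w\<in>I. coeff P w * f w)"
  unfolding ev_def using assms
  by (intro sum.mono_neutral_left) (auto simp: in_keys_iff)

lemma ev_zero [simp]: "ev f 0 = 0"
  by (simp add: ev_def)

lemma ev_add [simp]: "ev f (P + Q) = ev f P + ev f Q"
  using keys_add[of P Q]
  by (simp add: ev_superset[of "supp P \<union> supp Q"] lookup_add distrib_right sum.distrib)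

lemma ev_scale [simp]: "ev f (scale c P) = c * ev f P"
  using supp_scale[of c P]
  by (simp add: ev_superset[of "supp P"] coeff_scale sum_distrib_left mult.assoc)

lemma ev_single [simp]: "ev f (Poly_Mapping.single i c) = c * f i"
  by (simp add: ev_def)

lemma ev_one [simp]: "ev f (1 :: 'a list \<Rightarrow>\<^sub>0 'k::comm_ring_1) = f []"
  by (simp add: ev_def coeff_one_list)

lemma ev_lincomb: "ev g (lincomb f c) = ev (\<lambda>i. ev g (f i)) c"
  by (induct c rule: poly_induct) simp_all

lemma lincomb_lincomb: "lincomb f (lincomb g c) = lincomb (\<lambda>i. lincomb f (g i)) c"
  by (induct c rule: poly_induct) simp_all

lemma coeff_eq_ev: "coeff P w = ev (\<lambda>v. if v = w then 1 else 0) P"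
  by (induct P rule: poly_induct) (simp_all add: lookup_add coeff_scale lookup_single when_def)

lemma coeff_lincomb_ev: "coeff (lincomb f c) w = ev (\<lambda>i. coeff (f i) w) c"
  by (simp add: coeff_lincomb ev_def)

lemma supp_lincomb: "supp (lincomb f c) \<subseteq> (\<Union>i\<in>supp c. supp (f i))"
proof
  fix w
  assume "w \<in> supp (lincomb f c)"
  then have "(\<Sum>i\<in>supp c. coeff c i * coeff (f i) w) \<noteq> 0"
    by (simp add: in_keys_iff coeff_lincomb)
  then obtain i where "i \<in> supp c" "coeff c i * coeff (f i) w \<noteq> 0"
    by (rule sum.not_neutral_contains_not_neutral)
  then show "w \<in> (\<Union>i\<in>supp c. supp (f i))"
    by (intro UN_I[of i]) (auto simp: in_keys_iff)
qed

lemma lincomb_word_poly [simp]: "lincomb word_poly P = P"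
  by (induct P rule: poly_induct) simp_all

lemma ev_fun_zero [simp]: "ev (\<lambda>_. 0) P = 0"
  by (simp add: ev_def)

lemma ev_fun_add: "ev (\<lambda>w. f w + g w) P = ev f P + ev g P"
  by (simp add: ev_def distrib_left sum.distrib)

lemma ev_fun_mult: "ev (\<lambda>w. c * f w) P = c * ev f P"
  by (simp add: ev_def sum_distrib_left mult.left_commute)

lemma ev_cong: "P = Q \<Longrightarrow> (\<And>w. w \<in> supp Q \<Longrightarrow> f w = g w) \<Longrightarrow> ev f P = ev g Q"
  by (auto simp: ev_def intro: sum.cong)

lemma lincomb_cong: "P = Q \<Longrightarrow> (\<And>w. w \<in> supp Q \<Longrightarrow> f w = g w) \<Longrightarrow> lincomb f P = lincomb g Q"
  by (auto simp: lincomb_def intro: sum.cong)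

lemma coeff_word_poly_mult:
  fixes P :: "'a list \<Rightarrow>\<^sub>0 'k::comm_ring_1"
  shows "coeff (word_poly [a] * P) w =
    (case w of [] \<Rightarrow> 0 | b # v \<Rightarrow> if a = b then coeff P v else 0)"
  by (induct P rule: poly_induct)
    (auto simp: mult_single distrib_left lookup_add coeff_scale lookup_single when_def
      split: list.split)

section \<open>The product, the tensor product and the coproduct as linear maps\<close>

lemma pairing_eq_ev: "pairing P Q = ev (coeff Q) P"
  by (simp add: pairing_def ev_def)

lemma stuffle_eq_lincomb: "stuffle q P Q = lincomb (\<lambda>u. lincomb (stuffle_word q u) Q) P"
  by (simp add: stuffle_def lincomb_def poly.scale_sum_right)

lemma stuffle_add_left [simp]: "stuffle q (P + P') Q = stuffle q P Q + stuffle q P' Q"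
  by (simp add: stuffle_eq_lincomb)

lemma stuffle_scale_left [simp]: "stuffle q (scale c P) Q = scale c (stuffle q P Q)"
  by (simp add: stuffle_eq_lincomb)

lemma stuffle_add_right [simp]: "stuffle q P (Q + Q') = stuffle q P Q + stuffle q P Q'"
  by (induct P rule: poly_induct) (simp_all add: stuffle_eq_lincomb algebra_simps)

lemma stuffle_scale_right [simp]: "stuffle q P (scale c Q) = scale c (stuffle q P Q)"
  by (induct P rule: poly_induct) (simp_all add: stuffle_eq_lincomb algebra_simps)

lemma stuffle_words: "stuffle q (word_poly u) (word_poly v) = stuffle_word q u v"
  by (simp add: stuffle_eq_lincomb)

lemma stuffle_word_Nil_right [simp]: "stuffle_word q u [] = word_poly u"
  by (cases u) simp_all

lemma stuffle_one_left [simp]: "stuffle q 1 P = P"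
  by (induct P rule: poly_induct) (simp_all add: stuffle_eq_lincomb)

lemma stuffle_one_right [simp]: "stuffle q P 1 = P"
  by (induct P rule: poly_induct) (simp_all add: stuffle_eq_lincomb)

lemma tensor_eq_lincomb: "tensor P Q = lincomb (\<lambda>u. lincomb (\<lambda>v. word_poly (u, v)) Q) P"
  by (simp add: tensor_def lincomb_def poly.scale_sum_right)

lemma tensor_add_left [simp]: "tensor (P + P') Q = tensor P Q + tensor P' Q"
  by (simp add: tensor_eq_lincomb)

lemma tensor_scale_left [simp]: "tensor (scale c P) Q = scale c (tensor P Q)"
  by (simp add: tensor_eq_lincomb)

lemma tensor_add_right [simp]: "tensor P (Q + Q') = tensor P Q + tensor P Q'"
  by (induct P rule: poly_induct) (simp_all add: tensor_eq_lincomb algebra_simps)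

lemma tensor_scale_right [simp]: "tensor P (scale c Q) = scale c (tensor P Q)"
  by (induct P rule: poly_induct) (simp_all add: tensor_eq_lincomb algebra_simps)

lemma tensor_words [simp]: "tensor (word_poly u) (word_poly v) = word_poly (u, v)"
  by (simp add: tensor_eq_lincomb)

lemma tensor_one_word [simp]: "tensor 1 (word_poly v) = word_poly ([], v)"
  by (simp add: tensor_eq_lincomb)

lemma tensor_word_one [simp]: "tensor (word_poly v) 1 = word_poly (v, [])"
  by (simp add: tensor_eq_lincomb)

lemma tensor_one_one [simp]: "tensor 1 1 = 1"
  by (simp add: tensor_eq_lincomb)

lemma tensor_mult: "tensor P Q * tensor P' Q' = tensor (P * P') (Q * Q')"
proof (induct P rule: poly_induct)
  case (word u)
  show ?case
  proof (induct Q rule: poly_induct)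
    case (word v)
    show ?case
    proof (induct P' rule: poly_induct)
      case (word u')
      show ?case
        by (induct Q' rule: poly_induct) (simp_all add: mult_single algebra_simps)
    qed (simp_all add: algebra_simps)
  qed (simp_all add: algebra_simps)
qed (simp_all add: algebra_simps)

lemma tensor_zero_left [simp]: "tensor 0 Q = 0"
  by (simp add: tensor_eq_lincomb)

lemma tensor_zero_right [simp]: "tensor P 0 = 0"
  using tensor_scale_right[of P 0 0] by simp

lemma tensor_diff_left [simp]: "tensor (P - P') Q = tensor P Q - tensor P' Q"
  by (simp add: tensor_eq_lincomb)

lemma tensor_diff_right [simp]: "tensor P (Q - Q') = tensor P Q - tensor P Q'"
  by (metis add_diff_cancel_right' diff_add_cancel tensor_add_right)

lemma coeff_tensor: "coeff (tensor P Q) (u, v) = coeff P u * coeff Q v"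
proof (induct P rule: poly_induct)
  case (word u')
  show ?case
    by (induct Q rule: poly_induct)
      (simp_all add: lookup_add coeff_scale lookup_single when_def algebra_simps)
qed (simp_all add: lookup_add coeff_scale algebra_simps)

lemma coproduct_eq_lincomb:
  "coproduct q = lincomb (\<lambda>w. prod_list (map (coproduct_letter q) w))"
  by (simp add: fun_eq_iff coproduct_def lincomb_def)

lemma coproduct_add [simp]: "coproduct q (P + Q) = coproduct q P + coproduct q Q"
  and coproduct_diff [simp]: "coproduct q (P - Q) = coproduct q P - coproduct q Q"
  and coproduct_scale [simp]: "coproduct q (scale c P) = scale c (coproduct q P)"
  and coproduct_word: "coproduct q (word_poly w) = prod_list (map (coproduct_letter q) w)"
  and coproduct_one [simp]: "coproduct q 1 = 1"
  by (simp_all add: coproduct_eq_lincomb)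

lemma coproduct_mult: "coproduct q (P * Q) = coproduct q P * coproduct q Q"
proof (induct P rule: poly_induct)
  case (word u)
  show ?case
    by (induct Q rule: poly_induct) (simp_all add: mult_single coproduct_word algebra_simps)
qed (simp_all add: algebra_simps)

section \<open>Duality between product and coproduct\<close>

lemma index_ge_1: "1 \<le> index a"
  using index[of a] by simp

lemma index_letter [simp]: "1 \<le> s \<Longrightarrow> index (letter s) = s"
  by (simp add: letter_inverse)

lemma index_letter_add [simp]: "index (letter (index a + index b)) = index a + index b"
  using index_ge_1[of a] by (intro index_letter) simp

lemma letter_eq_iff: "a = b \<longleftrightarrow> index a = index b"
  by (simp add: index_inject)

lemma coeff_word_pair_mult_left:
  fixes X :: "'k::comm_ring_1 ncpoly2"
  shows "coeff (word_poly ([a], []) * X) (u, v) =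
    (case u of [] \<Rightarrow> 0 | b # u' \<Rightarrow> if a = b then coeff X (u', v) else 0)"
  by (induct X rule: poly_induct)
    (auto simp: mult_single distrib_left lookup_add coeff_scale lookup_single when_def
      plus_prod_def split: list.split)

lemma coeff_word_pair_mult_right:
  fixes X :: "'k::comm_ring_1 ncpoly2"
  shows "coeff (word_poly ([], [a]) * X) (u, v) =
    (case v of [] \<Rightarrow> 0 | b # v' \<Rightarrow> if a = b then coeff X (u, v') else 0)"
  by (induct X rule: poly_induct)
    (auto simp: mult_single distrib_left lookup_add coeff_scale lookup_single when_def
      plus_prod_def split: list.split)

lemma coeff_word_pair_mult:
  fixes X :: "'k::comm_ring_1 ncpoly2"
  shows "coeff (word_poly ([a], [b]) * X) (u, v) =
    (case (u, v) of (c # u', d # v') \<Rightarrow> if a = c \<and> b = d then coeff X (u', v') else 0 | _ \<Rightarrow> 0)"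
  by (induct X rule: poly_induct)
    (auto simp: mult_single distrib_left lookup_add coeff_scale lookup_single when_def
      plus_prod_def split: list.split)

text \<open>The three parts of the coproduct of a letter strip a letter from \<open>u\<close>, from
  \<open>v\<close>, or from both: the three terms of the \<open>q\<close>-stuffle recursion read
  backwards.\<close>

lemma coeff_coproduct_letter_mult:
  fixes X :: "'k::comm_ring_1 ncpoly2"
  shows "coeff (coproduct_letter q a * X) (u, v) =
    (case u of [] \<Rightarrow> 0 | b # u' \<Rightarrow> if a = b then coeff X (u', v) else 0) +
    (case v of [] \<Rightarrow> 0 | b # v' \<Rightarrow> if a = b then coeff X (u, v') else 0) +
    (case (u, v) of (c # u', d # v') \<Rightarrow>
       if index a = index c + index d then q * coeff X (u', v') else 0 | _ \<Rightarrow> 0)"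
proof -
  \<comment> \<open>The only candidate is \<open>i = index c\<close>; when the indices add up, it
    lies in the range because \<open>index d\<close> is at least 1.\<close>
  have "(\<Sum>i = 1..<index a. if letter i = c \<and> letter (index a - i) = d then x else (0::'k)) =
      (if index a = index c + index d then x else 0)" for c d x
  proof -
    have "(\<Sum>i = 1..<index a. if letter i = c \<and> letter (index a - i) = d then x else (0::'k)) =
        (\<Sum>i = 1..<index a. if i = index c then if index a = index c + index d then x else 0 else 0)"
      by (intro sum.cong) (auto simp: letter_eq_iff)
    also have "\<dots> = (if index a = index c + index d then x else 0)"
      using index_ge_1[of c] index_ge_1[of d] by (auto simp: sum.delta)
    finally show ?thesis .
  qed
  then have "coeff ((\<Sum>i = 1..<index a. word_poly ([letter i], [letter (index a - i)])) * X) (u, v) =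
      (case (u, v) of (c # u', d # v') \<Rightarrow>
        if index a = index c + index d then coeff X (u', v') else 0 | _ \<Rightarrow> 0)"
    by (auto simp: sum_distrib_right lookup_sum coeff_word_pair_mult split: list.split)
  then show ?thesis
    by (auto simp: coproduct_letter_def distrib_right lookup_add coeff_scale
        coeff_word_pair_mult_left coeff_word_pair_mult_right split: list.split)
qed

text \<open>Both sides obey the same recursion in the first letter of \<open>w\<close>, which is why
  the induction runs over \<open>w\<close> and not over \<open>u\<close> and
  \<open>v\<close>.\<close>

lemma coeff_stuffle_word: "coeff (stuffle_word q u v) w = coeff (coproduct q (word_poly w)) (u, v)"
proof (induct w arbitrary: u v)
  case Nil
  show ?case
    by (cases "(q, u, v)" rule: stuffle_word.cases)
      (auto simp: lookup_add lookup_single coeff_scale coeff_word_poly_mult coeff_one_list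
        lookup_one when_def)
next
  case (Cons a w)
  have *: "coeff (coproduct q (word_poly (a # w))) (u, v) =
      coeff (coproduct_letter q a * coproduct q (word_poly w)) (u, v)"
    by (simp add: coproduct_word)
  show ?case
    unfolding * coeff_coproduct_letter_mult Cons[symmetric]
    by (cases "(q, u, v)" rule: stuffle_word.cases)
      (auto simp: lookup_add coeff_scale coeff_word_poly_mult lookup_single lookup_one when_def
        letter_eq_iff split: list.split)
qed

lemma coeff_coproduct: "coeff (coproduct q P) (u, v) = ev (coeff P) (stuffle_word q u v)"
proof (induct P rule: poly_induct)
  case (word w)
  show ?case
    unfolding coeff_stuffle_word[symmetric] coeff_eq_ev[of "stuffle_word q u v"]
    by (rule ev_cong) (auto simp: lookup_single when_def)
qed (simp_all add: lookup_add coeff_scale ev_fun_add ev_fun_mult[symmetric] cong: ev_cong)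

text \<open>The right-hand side pairs the tensor of \<open>A\<close> and \<open>B\<close> with the
  coproduct of \<open>P\<close>. Products of members of \<open>Sigma_family\<close> are computed
  through this adjunction.\<close>

lemma pairing_stuffle:
  "pairing (stuffle q A B) P = ev (\<lambda>u. ev (\<lambda>v. coeff (coproduct q P) (u, v)) B) A"
  by (simp add: pairing_eq_ev stuffle_eq_lincomb ev_lincomb coeff_coproduct)

lemma pairing_add_left [simp]: "pairing (P + Q) R = pairing P R + pairing Q R"
  and pairing_scale_left [simp]: "pairing (scale c P) R = c * pairing P R"
  by (simp_all add: pairing_eq_ev)

lemma pairing_commute: "pairing P Q = pairing Q P"
proof -
  have "pairing P Q = (\<Sum>w\<in>supp P \<union> supp Q. coeff P w * coeff Q w)"
    "pairing Q P = (\<Sum>w\<in>supp P \<union> supp Q. coeff Q w * coeff P w)"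
    unfolding pairing_eq_ev by (intro ev_superset; auto)+
  then show ?thesis
    by (simp add: mult.commute)
qed

lemma pairing_lincomb: "pairing (lincomb f c) P = ev (\<lambda>i. pairing (f i) P) c"
  by (simp add: pairing_eq_ev ev_lincomb)

lemma pairing_word_left [simp]: "pairing (word_poly w) P = coeff P w"
  by (simp add: pairing_eq_ev)

section \<open>Commutativity and associativity of the product\<close>

lemma stuffle_commute: "stuffle q P Q = stuffle q Q P"
proof -
  have "stuffle_word q u v = stuffle_word q v u" for u v
    by (induct q u v rule: stuffle_word.induct) (simp_all add: ac_simps)
  then have *: "stuffle q (word_poly u) (word_poly v) = stuffle q (word_poly v) (word_poly u)" for u v
    by (simp add: stuffle_words)
  show ?thesis
  proof (induct P rule: poly_induct)
    case (word u)
    show ?case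
      by (induct Q rule: poly_induct) (simp_all only: * stuffle_add_left stuffle_add_right
        stuffle_scale_left stuffle_scale_right)
  qed simp_all
qed

text \<open>Associativity needs the recursion for tails that are themselves products, hence for
  arbitrary polynomials in place of words.\<close>

lemma stuffle_letter_mult:
  "stuffle q (word_poly [a] * P) (word_poly [b] * Q) =
     word_poly [a] * stuffle q P (word_poly [b] * Q) +
     word_poly [b] * stuffle q (word_poly [a] * P) Q +
     scale q (word_poly [letter (index a + index b)] * stuffle q P Q)"
proof (induct P rule: poly_induct)
  case (word u)
  show ?case
    by (induct Q rule: poly_induct) (simp_all add: mult_single stuffle_words algebra_simps)
qed (simp_all add: algebra_simps)

text \<open>Each hypothesis drops the leading letter from a nonempty subset of the three factors,
  whence seven of them.\<close>

lemma stuffle_assoc_step: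
  fixes q :: "'k::comm_ring_1" and U V W :: "'k ncpoly" and a b c :: letter
  defines "A \<equiv> word_poly [a] * U" and "B \<equiv> word_poly [b] * V" and "C \<equiv> word_poly [c] * W"
  assumes IH: "stuffle q (stuffle q U B) C = stuffle q U (stuffle q B C)"
    "stuffle q (stuffle q A V) C = stuffle q A (stuffle q V C)"
    "stuffle q (stuffle q A B) W = stuffle q A (stuffle q B W)"
    "stuffle q (stuffle q U V) C = stuffle q U (stuffle q V C)"
    "stuffle q (stuffle q U B) W = stuffle q U (stuffle q B W)"
    "stuffle q (stuffle q A V) W = stuffle q A (stuffle q V W)"
    "stuffle q (stuffle q U V) W = stuffle q U (stuffle q V W)"
  shows "stuffle q (stuffle q A B) C = stuffle q A (stuffle q B C)"
proof -
  let ?l = "\<lambda>s. word_poly [letter s] :: 'k ncpoly"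
  define X Y Z where "X = stuffle q U B" and "Y = stuffle q A V" and "Z = stuffle q U V"
  define X' Y' Z' where "X' = stuffle q V C" and "Y' = stuffle q B W" and "Z' = stuffle q V W"
  have AB: "stuffle q A B =
      word_poly [a] * X + word_poly [b] * Y + scale q (?l (index a + index b) * Z)"
    by (simp only: A_def B_def X_def Y_def Z_def stuffle_letter_mult)
  have BC: "stuffle q B C =
      word_poly [b] * X' + word_poly [c] * Y' + scale q (?l (index b + index c) * Z')"
    by (simp only: B_def C_def X'_def Y'_def Z'_def stuffle_letter_mult)
  \<comment> \<open>The terms starting with \<open>c\<close> alone are gathered back into the
    product of \<open>stuffle q A B\<close> with \<open>W\<close>, so that one hypothesis covers
    them. On the other side the same is done for the terms starting with \<open>a\<close>.\<close>
  have "stuffle q (stuffle q A B) C =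
      word_poly [a] * stuffle q X C + word_poly [b] * stuffle q Y C +
      scale q (?l (index a + index b) * stuffle q Z C) + word_poly [c] * stuffle q (stuffle q A B) W +
      scale q (?l (index a + index c) * stuffle q X W + ?l (index b + index c) * stuffle q Y W +
        scale q (?l (index a + index b + index c) * stuffle q Z W))"
    unfolding AB C_def by (simp add: stuffle_letter_mult algebra_simps)
  also have "\<dots> =
      word_poly [a] * stuffle q U (stuffle q B C) + word_poly [b] * stuffle q A X' +
      scale q (?l (index a + index b) * stuffle q U X') + word_poly [c] * stuffle q A Y' +
      scale q (?l (index a + index c) * stuffle q U Y' + ?l (index b + index c) * stuffle q A Z' +
        scale q (?l (index a + index b + index c) * stuffle q U Z'))"
    by (simp only: X_def Y_def Z_def X'_def Y'_def Z'_def IH)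
  also have "\<dots> = stuffle q A (stuffle q B C)"
    unfolding BC A_def by (simp add: stuffle_letter_mult algebra_simps)
  finally show ?thesis .
qed

lemma stuffle_assoc_words:
  "stuffle q (stuffle q (word_poly u) (word_poly v)) (word_poly w) =
     stuffle q (word_poly u) (stuffle q (word_poly v) (word_poly w))"
proof (induct "length u + length v + length w" arbitrary: u v w rule: less_induct)
  case less
  show ?case
  proof (cases "u = [] \<or> v = [] \<or> w = []")
    case True
    then show ?thesis
      by auto
  next
    case False
    then obtain a u' b v' c w' where [simp]: "u = a # u'" "v = b # v'" "w = c # w'"
      by (meson neq_Nil_conv)
    have Cons: "word_poly [x] * word_poly xs = (word_poly (x # xs) :: 'a ncpoly)" for x xs
      by (simp add: mult_single)
    show ?thesis
      using stuffle_assoc_step[of q "word_poly u'" b "word_poly v'" c "word_poly w'" a]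
        less[of u' v w] less[of u v' w] less[of u v w'] less[of u' v' w] less[of u' v w']
        less[of u v' w'] less[of u' v' w']
      by (simp only: Cons \<open>u = _\<close> \<open>v = _\<close> \<open>w = _\<close>) simp
  qed
qed

lemma stuffle_assoc: "stuffle q (stuffle q P Q) R = stuffle q P (stuffle q Q R)"
proof (induct P rule: poly_induct)
  case (word u)
  show ?case
  proof (induct Q rule: poly_induct)
    case (word v)
    show ?case
      by (induct R rule: poly_induct) (simp_all add: stuffle_assoc_words)
  qed simp_all
qed simp_all

text \<open>This gives the finite product in \<open>stuffle_monomial\<close> its order-independent
  meaning.\<close>

lemma comm_monoid_stuffle: "comm_monoid (stuffle q) 1"
  by standard (rule stuffle_assoc, rule stuffle_commute, simp)

section \<open>Lyndon words\<close>

lemma append_less_append_left [simp]: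
  "u @ v < u @ w \<longleftrightarrow> v < (w :: 'a::linorder list)"
  by (induct u) auto

lemma le_append [simp]: "u \<le> u @ (v :: 'a::linorder list)"
  by (induct u) auto

text \<open>Outside the prefix case the order is decided at a position inside both words, and
  nothing appended can change it.\<close>

lemma append_less_append:
  fixes u v :: "'a::linorder list"
  assumes "u < v" "\<not> prefix u v"
  shows "u @ x < v @ y"
  using assms
proof (induct u arbitrary: v)
  case (Cons a u)
  then show ?case
    by (cases v) auto
qed simp

lemma suffix_finite: "finite {v. suffix v w}"
  by (simp flip: set_suffixes_eq)

lemma lyndonD: "lyndon w \<Longrightarrow> w = x @ y \<Longrightarrow> x \<noteq> [] \<Longrightarrow> y \<noteq> [] \<Longrightarrow> w < y"
  by (auto simp: lyndon_def strict_suffix_def suffix_def)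

lemma lyndonI:
  assumes "w \<noteq> []" "\<And>x y. w = x @ y \<Longrightarrow> x \<noteq> [] \<Longrightarrow> y \<noteq> [] \<Longrightarrow> w < y"
  shows "lyndon w"
  using assms by (auto simp: lyndon_def strict_suffix_def suffix_def)

lemma lyndon_le_suffix: "lyndon w \<Longrightarrow> suffix v w \<Longrightarrow> v \<noteq> [] \<Longrightarrow> w \<le> v"
  by (cases "v = w") (auto simp: lyndon_def strict_suffix_def)

lemma not_lyndon_Nil [simp]: "\<not> lyndon []"
  by (simp add: lyndon_def)

text \<open>The main point is \<open>u @ v < v\<close>: if \<open>v\<close> is \<open>u\<close>
  followed by \<open>v'\<close>, this amounts to \<open>v < v'\<close>, otherwise a letter decides.
  A proper suffix that starts within \<open>u\<close> exceeds \<open>u\<close> already at some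
  letter, because the part of it inside \<open>u\<close> is shorter than \<open>u\<close>.\<close>

lemma lyndon_append:
  assumes u: "lyndon u" and v: "lyndon v" and "u < v"
  shows "lyndon (u @ v)"
proof (rule lyndonI)
  show "u @ v \<noteq> []"
    using u by auto
  have uv: "u @ v < v"
  proof (cases "prefix u v")
    case True
    then obtain v' where v': "v = u @ v'"
      by (auto simp: prefix_def)
    with \<open>u < v\<close> u have "v < v'"
      by (intro lyndonD[OF v v']) auto
    then show ?thesis
      by (subst (2) v') simp
  next
    case False
    then show ?thesis
      using append_less_append[of u v v "[]"] \<open>u < v\<close> by simp
  qed
  fix x y
  assume xy: "u @ v = x @ y" "x \<noteq> []" "y \<noteq> []"
  then consider us where "u = x @ us" "y = us @ v" | us where "x = u @ us" "v = us @ y"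
    by (auto simp: append_eq_append_conv2)
  then show "u @ v < y"
  proof cases
    case 1
    show ?thesis
    proof (cases "us = []")
      case False
      have "u < us"
        by (rule lyndonD[OF u 1(1) xy(2) False])
      moreover have "\<not> prefix u us"
        using 1(1) xy(2) by (auto dest: prefix_length_le)
      ultimately show ?thesis
        unfolding 1(2) by (rule append_less_append)
    qed (use 1 uv in simp)
  next
    case 2
    show ?thesis
    proof (cases "us = []")
      case False
      show ?thesis
        using uv lyndonD[OF v 2(2) False xy(3)] by simp
    qed (use 2 uv in simp)
  qed
qed

text \<open>Let \<open>v\<close> be the smallest nonempty suffix of \<open>s\<close>; it is Lyndon.
  Were it proper, then \<open>v < r\<close> would make \<open>v @ r\<close> a Lyndon proper suffix
  of \<open>l\<close> longer than \<open>r\<close>, while \<open>r \<le> v\<close> contradicts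
  \<open>v \<le> s \<le> l < r\<close>.\<close>

lemma lyndon_std_left:
  assumes l: "lyndon l" "2 \<le> length l"
  shows "lyndon (std_left l)"
proof -
  define s r where "s = std_left l" and "r = std_right l"
  have l_eq: "l = s @ r"
    using std_left_append_std_right[OF l(2)] by (simp add: s_def r_def)
  have r: "strict_suffix r l" "lyndon r"
    using std_right[OF l(2)] by (simp_all add: r_def)
  have s: "s \<noteq> []"
    using r(1) l_eq by auto
  have longest: "length t \<le> length r" if "strict_suffix t l" "lyndon t" for t
    unfolding r_def std_right_def
    by (rule arg_max_nat_le[of "\<lambda>t. strict_suffix t l \<and> lyndon t" _ length "length l"])
      (use that in \<open>auto intro: suffix_length_less\<close>)
  define v where "v = Min {v. suffix v s \<and> v \<noteq> []}"
  have fin: "finite {v. suffix v s \<and> v \<noteq> []}"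
    by (rule finite_subset[OF _ suffix_finite[of s]]) auto
  have v: "suffix v s" "v \<noteq> []"
    using Min_in[OF fin] s by (auto simp: v_def)
  have v_le: "v \<le> t" if "suffix t s" "t \<noteq> []" for t
    unfolding v_def by (rule Min_le) (use fin that in auto)
  have "lyndon v"
  proof (rule lyndonI[OF v(2)])
    fix x y
    assume "v = x @ y" "x \<noteq> []" "y \<noteq> []"
    then show "v < y"
      using v_le[of y] v(1) by (auto simp: suffix_def order_le_less)
  qed
  show ?thesis
  proof (cases "v = s")
    case False
    then obtain x where x: "s = x @ v" "x \<noteq> []"
      using v(1) by (auto simp: suffix_def)
    have "\<not> v < r"
    proof
      assume "v < r"
      then have "lyndon (v @ r)"
        using \<open>lyndon v\<close> r(2) by (intro lyndon_append)
      moreover have "strict_suffix (v @ r) l"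
        using x by (auto simp: l_eq strict_suffix_def suffix_def)
      ultimately show False
        using longest[of "v @ r"] v(2) by simp
    qed
    moreover have "v \<le> s"
      using v_le s by simp
    moreover have "r \<noteq> []"
      using r(2) by auto
    with lyndonD[OF l(1) l_eq s] have "s \<le> l" "l < r"
      by (simp_all add: l_eq)
    ultimately show ?thesis
      by simp
  qed (use \<open>lyndon v\<close> s_def in simp)
qed

section \<open>Existence and uniqueness of the Chen-Fox-Lyndon factorization\<close>

definition lyndon_list :: "lword list \<Rightarrow> bool" where
  "lyndon_list ls \<longleftrightarrow> (\<forall>l\<in>set ls. lyndon l) \<and> sorted_wrt (\<ge>) ls"

lemma lyndon_list_Cons:
  "lyndon_list (l # ls) \<longleftrightarrow> lyndon l \<and> (\<forall>k\<in>set ls. k \<le> l) \<and> lyndon_list ls"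
  by (auto simp: lyndon_list_def)

lemma lyndon_list_Nil [simp]: "lyndon_list []"
  by (simp add: lyndon_list_def)

text \<open>A suffix that starts inside a factor \<open>k\<close> has as prefix a nonempty suffix of
  \<open>k\<close>, which is at least \<open>k\<close> and so at least \<open>l\<close>. Thus the
  last factor is the least nonempty suffix, a characterization by the word alone.\<close>

lemma lyndon_list_last_le_suffix:
  assumes "lyndon_list (ls @ [l])" "suffix t (concat ls @ l)" "t \<noteq> []"
  shows "l \<le> t"
  using assms
proof (induct ls)
  case Nil
  then show ?case
    by (auto simp: lyndon_list_def intro: lyndon_le_suffix)
next
  case (Cons k ls)
  show ?case
  proof (cases "suffix t (concat ls @ l)")
    case True
    then show ?thesis
      using Cons by (simp add: lyndon_list_Cons)
  next
    case False
    with Cons(3) obtain x where x: "t = x @ concat ls @ l" "suffix x k"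
      by (auto simp: suffix_append)
    with False have "x \<noteq> []"
      by auto
    with Cons(2) x(2) have "l \<le> k" "k \<le> x"
      by (auto simp: lyndon_list_Cons intro: lyndon_le_suffix)
    moreover have "x \<le> t"
      by (simp add: x)
    ultimately show ?thesis
      by simp
  qed
qed

lemma lyndon_list_unique:
  assumes "lyndon_list ls" "lyndon_list ls'" "concat ls = concat ls'"
  shows "ls = ls'"
  using assms
proof (induct ls arbitrary: ls' rule: rev_induct)
  case Nil
  then show ?case
    by (cases ls') (auto simp: lyndon_list_def)
next
  case (snoc l ls)
  have "l \<noteq> []"
    using snoc(2) by (auto simp: lyndon_list_def)
  with snoc(4) obtain ks k where ls': "ls' = ks @ [k]"
    by (cases ls' rule: rev_cases) auto
  have "k \<noteq> []"
    using snoc(3) by (auto simp: lyndon_list_def ls')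
  have eq: "concat ls @ l = concat ks @ k"
    using snoc(4) ls' by simp
  have "l \<le> k"
    by (rule lyndon_list_last_le_suffix[OF snoc(2) _ \<open>k \<noteq> []\<close>]) (simp add: eq suffixI)
  moreover have "k \<le> l"
    by (rule lyndon_list_last_le_suffix[OF snoc(3)[unfolded ls'] _ \<open>l \<noteq> []\<close>])
      (simp add: eq[symmetric] suffixI)
  ultimately have "k = l"
    by simp
  with snoc(1)[of ks] snoc(2,3) eq show ?case
    by (auto simp: ls' lyndon_list_def sorted_wrt_append)
qed

text \<open>A head \<open>l\<close> larger than \<open>u\<close> is absorbed: \<open>u @ l\<close>
  is again Lyndon and is inserted into the remaining list.\<close>

lemma lyndon_list_insert:
  assumes "lyndon u" "lyndon_list ls"
  shows "\<exists>ls'. lyndon_list ls' \<and> concat ls' = u @ concat ls"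
  using assms
proof (induct ls arbitrary: u)
  case Nil
  then show ?case
    by (intro exI[of _ "[u]"]) (simp add: lyndon_list_def)
next
  case (Cons l ls)
  show ?case
  proof (cases "l \<le> u")
    case True
    then show ?thesis
      using Cons by (intro exI[of _ "u # l # ls"]) (auto simp: lyndon_list_Cons)
  next
    case False
    then show ?thesis
      using Cons(1)[of "u @ l"] Cons(2,3) lyndon_append[of u l] by (simp add: lyndon_list_Cons)
  qed
qed

lemma lyndon_list_exists: "\<exists>ls. lyndon_list ls \<and> concat ls = w"
proof (induct w)
  case (Cons a w)
  then show ?case
    using lyndon_list_insert[OF lyndon_singleton] by fastforce
qed (auto intro: exI[of _ "[]"])

text \<open>Repeated factors are listed separately, so that products over the factors and splittings
  of the list need no exponents.\<close>

definition lfac :: "lword \<Rightarrow> lword list" where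
  "lfac w = (THE ls. lyndon_list ls \<and> concat ls = w)"

lemma lfac: "lyndon_list (lfac w)" "concat (lfac w) = w"
proof -
  have "\<exists>!ls. lyndon_list ls \<and> concat ls = w"
    using lyndon_list_exists lyndon_list_unique by blast
  from theI'[OF this] show "lyndon_list (lfac w)" "concat (lfac w) = w"
    by (simp_all add: lfac_def)
qed

lemma lfac_concat: "lyndon_list ls \<Longrightarrow> lfac (concat ls) = ls"
  using lfac lyndon_list_unique by blast

lemma lfac_lyndon: "lyndon l \<Longrightarrow> lfac l = [l]"
  using lfac_concat[of "[l]"] by (simp add: lyndon_list_def)

lemma lfac_Nil [simp]: "lfac [] = []"
  using lfac_concat[of "[]"] by simp

section \<open>Lists of factors versus lists of factors with exponents\<close>

definition flatten_pairs :: "('a \<times> nat) list \<Rightarrow> 'a list" where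
  "flatten_pairs ps = concat (map (\<lambda>(l, i). replicate i l) ps)"

lemma flatten_pairs_simps [simp]:
  "flatten_pairs [] = []"
  "flatten_pairs ((l, i) # ps) = replicate i l @ flatten_pairs ps"
  by (simp_all add: flatten_pairs_def)

definition strict_pairs :: "('a::linorder \<times> nat) list \<Rightarrow> bool" where
  "strict_pairs ps \<longleftrightarrow> (\<forall>p\<in>set ps. 1 \<le> snd p) \<and> sorted_wrt (\<lambda>l l'. l > l') (map fst ps)"

lemma strict_pairs_Cons:
  "strict_pairs ((l, i) # ps) \<longleftrightarrow> 1 \<le> i \<and> (\<forall>k\<in>fst ` set ps. k < l) \<and> strict_pairs ps"
  by (auto simp: strict_pairs_def)

lemma set_flatten_pairs: "strict_pairs ps \<Longrightarrow> set (flatten_pairs ps) = fst ` set ps"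
  by (induct ps) (force simp: strict_pairs_Cons)+

lemma sorted_flatten_pairs: "strict_pairs ps \<Longrightarrow> sorted_wrt (\<ge>) (flatten_pairs ps)"
proof (induct ps)
  case (Cons p ps)
  obtain l i where p: "p = (l, i)"
    by (cases p)
  have "sorted_wrt (\<ge>) (replicate i l)"
    by (induct i) auto
  with Cons show ?case
    by (auto simp: p strict_pairs_Cons sorted_wrt_append set_flatten_pairs order_less_imp_le)
qed simp

text \<open>The heads agree, being the first entries of the flattened lists; the exponents agree
  because the head occurs in the first pair only, so counting it gives its exponent.\<close>

lemma flatten_pairs_inject:
  assumes "strict_pairs ps" "strict_pairs ps'" "flatten_pairs ps = flatten_pairs ps'"
  shows "ps = ps'"
  using assms
proof (induct ps arbitrary: ps')
  case Nil
  then show ?case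
    by (cases ps') (auto simp: strict_pairs_def)
next
  case (Cons p ps)
  obtain l i where p: "p = (l, i)"
    by (cases p)
  obtain k j ps'' where ps': "ps' = (k, j) # ps''"
    using Cons(2,4) p by (cases ps') (auto simp: strict_pairs_Cons)
  have pos: "1 \<le> i" "1 \<le> j" and less: "\<forall>m\<in>set (flatten_pairs ps). m < l" "\<forall>m\<in>set (flatten_pairs ps''). m < k"
    and strict: "strict_pairs ps" "strict_pairs ps''"
    using Cons(2,3) by (auto simp: p ps' strict_pairs_Cons set_flatten_pairs)
  have eq: "replicate i l @ flatten_pairs ps = replicate j k @ flatten_pairs ps''"
    using Cons(4) by (simp add: p ps')
  then have "hd (replicate i l @ flatten_pairs ps) = hd (replicate j k @ flatten_pairs ps'')"
    by simp
  with pos have [simp]: "k = l"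
    by (simp add: hd_append)
  have "filter ((=) l) (flatten_pairs ps) = []" "filter ((=) l) (flatten_pairs ps'') = []"
    using less by (auto simp: filter_empty_conv)
  with arg_cong[OF eq, of "\<lambda>xs. length (filter ((=) l) xs)"] have "i = j"
    by simp
  with eq Cons(1)[OF strict] show ?case
    by (simp add: p ps')
qed

lemma flatten_pairs_exists:
  assumes "sorted_wrt (\<ge>) ls"
  shows "\<exists>ps. strict_pairs ps \<and> flatten_pairs ps = ls"
  using assms
proof (induct ls)
  case Nil
  then show ?case
    by (intro exI[of _ "[]"]) (simp add: strict_pairs_def)
next
  case (Cons l ls)
  then obtain ps where ps: "strict_pairs ps" "flatten_pairs ps = ls"
    by auto
  have le: "\<forall>k\<in>fst ` set ps. k \<le> l"
    using Cons(2) set_flatten_pairs[OF ps(1)] ps(2) by auto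
  show ?case
  proof (cases "ps \<noteq> [] \<and> fst (hd ps) = l")
    case True
    then obtain i ps' where "ps = (l, i) # ps'"
      by (cases ps) auto
    then show ?thesis
      using ps by (intro exI[of _ "(l, Suc i) # ps'"]) (auto simp: strict_pairs_Cons)
  next
    case False
    have "\<forall>k\<in>fst ` set ps. k < l"
    proof (cases ps)
      case (Cons p ps')
      then show ?thesis
        using False le ps(1) by (cases p) (auto simp: strict_pairs_Cons)
    qed simp
    then show ?thesis
      using ps by (intro exI[of _ "(l, 1) # ps"]) (simp add: strict_pairs_Cons)
  qed
qed

text \<open>The condition under the definite description says that the pairs are strict and flatten
  to \<open>lfac w\<close>, so the description has exactly one solution.\<close>

lemma flatten_lyndon_factorization: "flatten_pairs (lyndon_factorization w) = lfac w"
proof -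
  have concat_eq: "concat (map (\<lambda>(l, i). concat (replicate i l)) ps) = concat (flatten_pairs ps)"
    for ps :: "(lword \<times> nat) list"
    by (induct ps) auto
  have *: "(\<forall>(l, i) \<in> set ps. lyndon l \<and> 1 \<le> i) \<and> sorted_wrt (\<lambda>l l'. l > l') (map fst ps) \<and>
      w = concat (map (\<lambda>(l, i). concat (replicate i l)) ps) \<longleftrightarrow>
      strict_pairs ps \<and> flatten_pairs ps = lfac w" for ps
  proof safe
    assume "\<forall>(l, i) \<in> set ps. lyndon l \<and> 1 \<le> i" "sorted_wrt (\<lambda>l l'. l > l') (map fst ps)"
    then have "strict_pairs ps" "\<forall>l\<in>fst ` set ps. lyndon l"
      by (auto simp: strict_pairs_def)
    then have "lyndon_list (flatten_pairs ps)" "strict_pairs ps"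
      by (simp_all add: lyndon_list_def set_flatten_pairs sorted_flatten_pairs)
    then show "strict_pairs ps"
      "flatten_pairs ps = lfac (concat (map (\<lambda>(l, i). concat (replicate i l)) ps))"
      by (simp_all add: concat_eq lfac_concat)
  next
    assume ps: "strict_pairs ps" "flatten_pairs ps = lfac w"
    then have "\<forall>l\<in>fst ` set ps. lyndon l"
      using lfac(1)[of w] set_flatten_pairs[of ps] by (auto simp: lyndon_list_def)
    then show "lyndon l" "1 \<le> i" if "(l, i) \<in> set ps" for l i
      using that ps(1) by (force simp: strict_pairs_def)+
    show "sorted_wrt (\<lambda>l l'. l > l') (map fst ps)"
      using ps(1) by (simp add: strict_pairs_def)
    show "w = concat (map (\<lambda>(l, i). concat (replicate i l)) ps)"
      by (simp add: concat_eq ps(2) lfac(2))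
  qed
  have "sorted_wrt (\<ge>) (lfac w)"
    using lfac(1) by (simp add: lyndon_list_def)
  then have "\<exists>!ps. strict_pairs ps \<and> flatten_pairs ps = lfac w"
    using flatten_pairs_exists flatten_pairs_inject by metis
  from theI'[OF this] show ?thesis
    unfolding lyndon_factorization_def * by simp
qed

lemma Pi_family_eq: "Pi_family q w = prod_list (map (Pi_lyndon q) (lfac w))"
proof -
  have "prod_list (map (\<lambda>(l, i). f l ^ i) ps) = prod_list (map f (flatten_pairs ps))"
    for ps and f :: "lword \<Rightarrow> 'a ncpoly"
  proof (induct ps)
    case (Cons p ps)
    have "prod_list (replicate i x) = x ^ i" for i and x :: "'a ncpoly"
      by (induct i) simp_all
    with Cons show ?case
      by (cases p) simp
  qed simp
  then show ?thesis
    by (simp add: Pi_family_def flatten_lyndon_factorization)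
qed

section \<open>Words as multisets of Lyndon words\<close>

definition lmset :: "lword \<Rightarrow> lword multiset" where
  "lmset w = mset (lfac w)"

text \<open>With \<open>lmset\<close> this identifies words with finite multisets of Lyndon words,
  where the product of the dual family becomes addition of indices. The reversal turns ascending
  order into the nonincreasing order of the factors.\<close>

definition word_of_lmset :: "lword multiset \<Rightarrow> lword" where
  "word_of_lmset M = concat (rev (sorted_list_of_multiset M))"

lemma lyndon_list_eq_rev_sorted:
  "lyndon_list ls \<Longrightarrow> ls = rev (sorted_list_of_multiset (mset ls))"
  by (metis lyndon_list_def mset_rev rev_swap sorted_list_of_multiset_mset sorted_sort_id sorted_wrt_rev)

lemma word_of_lmset_lmset [simp]: "word_of_lmset (lmset w) = w"
  by (metis lfac lmset_def lyndon_list_eq_rev_sorted word_of_lmset_def)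

lemma lmset_word_of_lmset: "(\<And>l. l \<in># M \<Longrightarrow> lyndon l) \<Longrightarrow> lmset (word_of_lmset M) = M"
  unfolding lmset_def word_of_lmset_def
  by (subst lfac_concat) (auto simp: lyndon_list_def sorted_wrt_rev)

lemma lmset_inject: "lmset u = lmset v \<longleftrightarrow> u = v"
  by (metis word_of_lmset_lmset)

lemma lmset_concat: "lyndon_list ls \<Longrightarrow> lmset (concat ls) = mset ls"
  by (simp add: lmset_def lfac_concat)

section \<open>Bases\<close>

text \<open>\<open>is_basis\<close> speaks of the set of values, these premises of the family.
  Injectivity bridges the two: equal members would give a relation with coefficients 1 and
  -1.\<close>

lemma is_basisI:
  assumes indep: "\<And>c. supp c \<subseteq> I \<Longrightarrow> lincomb f c = 0 \<Longrightarrow> c = 0"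
    and span: "\<And>P. P \<in> M \<longleftrightarrow> (\<exists>c. supp c \<subseteq> I \<and> lincomb f c = P)"
  shows "is_basis I f M"
proof -
  have inj: "inj_on f I"
  proof (rule inj_onI, rule ccontr)
    fix i j
    assume ij: "i \<in> I" "j \<in> I" "f i = f j" "i \<noteq> j"
    let ?c = "word_poly i - word_poly j :: 'a \<Rightarrow>\<^sub>0 'b"
    have "?c = 0"
      using ij by (intro indep) (auto simp: in_keys_iff lookup_minus lookup_single when_def split: if_splits)
    moreover have "coeff ?c i = 1"
      using ij by (simp add: lookup_minus lookup_single)
    ultimately show False
      by simp
  qed
  have "poly.independent (f ` I)"
    unfolding poly.independent_explicit_module
  proof (intro allI impI)
    fix t u v
    assume t: "finite t" "t \<subseteq> f ` I" "(\<Sum>v\<in>t. scale (u v) v) = 0" "v \<in> t"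
    then obtain J where J: "J \<subseteq> I" "t = f ` J"
      by (meson subset_imageE)
    have inj_J: "inj_on f J"
      using inj J(1) by (rule inj_on_subset)
    then have "finite J"
      using t(1) J(2) by (simp add: finite_image_iff)
    define c where "c = (\<Sum>j\<in>J. Poly_Mapping.single j (u (f j)))"
    have c: "coeff c j = (if j \<in> J then u (f j) else 0)" for j
      using \<open>finite J\<close> by (simp add: c_def lookup_sum lookup_single when_def)
    have "lincomb f c = 0"
      using t(3) inj_J by (simp add: c_def J(2) sum.reindex)
    moreover have "supp c \<subseteq> I"
      using J(1) by (auto simp: in_keys_iff c split: if_splits)
    ultimately have "c = 0"
      by (rule indep[rotated])
    moreover obtain j where "j \<in> J" "v = f j"
      using t(4) J(2) by auto
    ultimately show "u v = 0"
      using c[of j] by simp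
  qed
  moreover have "poly.span (f ` I) = M"
  proof (rule poly.span_subspace)
    show "f ` I \<subseteq> M"
    proof
      fix P
      assume "P \<in> f ` I"
      then obtain i where "i \<in> I" "P = f i"
        by auto
      then show "P \<in> M"
        by (subst span) (auto intro!: exI[of _ "word_poly i"])
    qed
    show "M \<subseteq> poly.span (f ` I)"
    proof
      fix P
      assume "P \<in> M"
      then obtain c where "supp c \<subseteq> I" "lincomb f c = P"
        by (auto simp: span)
      moreover from this have "lincomb f c \<in> poly.span (f ` I)"
        unfolding lincomb_def by (intro poly.span_sum poly.span_scale poly.span_base) auto
      ultimately show "P \<in> poly.span (f ` I)"
        by simp
    qed
    show "poly.subspace M"
    proof (rule poly.subspaceI)
      show "0 \<in> M"
        by (subst span) (auto intro: exI[of _ 0])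
      show "P + Q \<in> M" if PQ: "P \<in> M" "Q \<in> M" for P Q
      proof -
        obtain c d where "supp c \<subseteq> I" "lincomb f c = P" "supp d \<subseteq> I" "lincomb f d = Q"
          using PQ by (auto simp: span)
        then show ?thesis
          using keys_add[of c d] by (subst span) (auto intro!: exI[of _ "c + d"])
      qed
      show "scale a P \<in> M" if P: "P \<in> M" for a P
      proof -
        obtain c where "supp c \<subseteq> I" "lincomb f c = P"
          using P by (auto simp: span)
        then show ?thesis
          using supp_scale[of a c] by (subst span) (auto intro!: exI[of _ "scale a c"])
      qed
    qed
  qed
  ultimately show ?thesis
    using inj by (simp add: is_basis_def)
qed

section \<open>Homogeneity and triangularity\<close>

definition weight :: "lword \<Rightarrow> nat" where
  "weight w = sum_list (map index w)"

lemma weight_simps [simp]: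
  "weight [] = 0" "weight (a # w) = index a + weight w" "weight (u @ v) = weight u + weight v"
  by (simp_all add: weight_def)

lemma weight_eq_0_iff [simp]: "weight w = 0 \<longleftrightarrow> w = []"
  using index_ge_1 by (cases w) (auto simp: Suc_le_eq)

lemma weight_letter: "a \<in> set w \<Longrightarrow> index a \<le> weight w"
  by (induct w) auto

lemma length_le_weight: "length w \<le> weight w"
proof (induct w)
  case (Cons a w)
  then show ?case
    using index_ge_1[of a] by simp
qed simp

lemma finite_weight: "finite {w. weight w = n}"
proof -
  have "set w \<subseteq> letter ` {..weight w}" for w
  proof
    fix a
    assume "a \<in> set w"
    then show "a \<in> letter ` {..weight w}"
      using weight_letter[of a w] index_inverse[of a] by (intro image_eqI[of _ _ "index a"]) simp_all
  qed
  then have "{w. weight w = n} \<subseteq> {w. set w \<subseteq> letter ` {..n} \<and> length w \<le> n}"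
    using length_le_weight by auto
  then show ?thesis
    by (rule finite_subset) (simp add: finite_lists_length_le)
qed

lemma weight_stuffle_word: "w \<in> supp (stuffle_word q u v) \<Longrightarrow> weight w = weight u + weight v"
proof (induct q u v arbitrary: w rule: stuffle_word.induct)
  case (3 q a u b v)
  show ?case
  proof (cases w)
    case Nil
    with 3 show ?thesis
      by (simp add: in_keys_iff lookup_add coeff_scale coeff_word_poly_mult)
  next
    case (Cons c w')
    then have "a = c \<and> w' \<in> supp (stuffle_word q u (b # v)) \<or>
        b = c \<and> w' \<in> supp (stuffle_word q (a # u) v) \<or>
        letter (index a + index b) = c \<and> w' \<in> supp (stuffle_word q u v)"
      using 3(4)
      by (auto simp: in_keys_iff lookup_add coeff_scale coeff_word_poly_mult split: if_splits)
    then show ?thesis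
      using 3(1-3) Cons by auto
  qed
qed (auto split: if_splits)

definition words_above :: "lword \<Rightarrow> lword set" where
  "words_above w = {v. weight v = weight w \<and> w < v}"

definition unitri :: "lword \<Rightarrow> 'k::comm_ring_1 ncpoly \<Rightarrow> bool" where
  "unitri w P \<longleftrightarrow> supp (P - word_poly w) \<subseteq> words_above w"

lemma words_above_append_right: "v \<in> words_above w \<Longrightarrow> u @ v \<in> words_above (u @ w)"
  by (simp add: words_above_def)

text \<open>Equality of weights rules out that \<open>u\<close> is a prefix of \<open>v\<close>, so
  a letter decides, however \<open>x\<close> and \<open>y\<close> compare.\<close>

lemma words_above_append:
  assumes "v \<in> words_above u" "weight x = weight y"
  shows "v @ y \<in> words_above (u @ x)"
proof -
  have "\<not> prefix u v"
    using assms(1) by (auto simp: words_above_def prefix_def)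
  with assms show ?thesis
    by (auto simp: words_above_def intro: append_less_append)
qed

lemma words_above_weight: "v \<in> words_above u \<Longrightarrow> weight v = weight u"
  by (simp add: words_above_def)

text \<open>With remainders \<open>P'\<close> and \<open>Q'\<close>, the difference is
  \<open>word_poly u * Q' + P' * Q\<close>. In the first product words are raised by their right
  part, in the second already by their left part.\<close>

lemma unitri_mult:
  assumes "unitri u P" "unitri v Q"
  shows "unitri (u @ v) (P * Q)"
proof -
  define P' Q' where "P' = P - word_poly u" and "Q' = Q - word_poly v"
  have PQ: "P = word_poly u + P'" "Q = word_poly v + Q'"
    by (simp_all add: P'_def Q'_def)
  have supp: "supp P' \<subseteq> words_above u" "supp Q' \<subseteq> words_above v"
    using assms by (simp_all add: unitri_def P'_def Q'_def)
  have "P * Q - word_poly (u @ v) = word_poly u * Q' + P' * Q"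
    by (simp add: PQ algebra_simps mult_single)
  moreover have "supp (word_poly u * Q') \<subseteq> words_above (u @ v)"
  proof
    fix w
    assume "w \<in> supp (word_poly u * Q')"
    then obtain y where "w = u @ y" "y \<in> supp Q'"
      using keys_mult[of "word_poly u" Q'] by auto
    then show "w \<in> words_above (u @ v)"
      using supp(2) by (auto intro: words_above_append_right)
  qed
  moreover have "supp (P' * Q) \<subseteq> words_above (u @ v)"
  proof
    fix w
    assume "w \<in> supp (P' * Q)"
    then obtain x y where w: "w = x @ y" "x \<in> supp P'" "y \<in> supp Q"
      using keys_mult[of P' Q] by auto
    have "supp Q \<subseteq> insert v (words_above v)"
      using keys_add[of "word_poly v" Q'] supp(2) by (auto simp: PQ)
    then have "y \<in> insert v (words_above v)" "x \<in> words_above u"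
      using w supp(1) by blast+
    then have "x \<in> words_above u" "weight v = weight y"
      by (auto dest: words_above_weight)
    then show "w \<in> words_above (u @ v)"
      unfolding w(1) by (rule words_above_append)
  qed
  ultimately show ?thesis
    using keys_add[of "word_poly u * Q'" "P' * Q"] by (auto simp: unitri_def)
qed

lemma supp_unitri: "unitri w P \<Longrightarrow> supp P \<subseteq> insert w (words_above w)"
  using keys_add[of "P - word_poly w" "word_poly w"] by (auto simp: unitri_def)

lemma weight_supp_unitri: "unitri w P \<Longrightarrow> v \<in> supp P \<Longrightarrow> weight v = weight w"
  using supp_unitri words_above_weight by blast

text \<open>Back substitution: the correction terms of \<open>f w\<close> lie above
  \<open>w\<close>, and fewer words lie above each of them. The solution is again unitriangular, so
  the inverse matrix preserves weight.\<close>

lemma unitri_inverse: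
  fixes f :: "lword \<Rightarrow> 'k::comm_ring_1 ncpoly"
  assumes "\<And>w. unitri w (f w)"
  shows "\<exists>c. lincomb f c = word_poly w \<and> unitri w c"
proof (induct "card (words_above w)" arbitrary: w rule: less_induct)
  case less
  have fin: "finite (words_above v)" for v
    by (rule finite_subset[OF _ finite_weight[of "weight v"]]) (auto simp: words_above_def)
  define R where "R = f w - word_poly w"
  have R: "supp R \<subseteq> words_above w"
    using assms[of w] by (simp add: unitri_def R_def)
  have words_above_trans: "words_above v \<subset> words_above w" if "v \<in> words_above w" for v
    using that by (auto simp: words_above_def)
  have "\<exists>c. lincomb f c = word_poly v \<and> unitri v c" if "v \<in> supp R" for v
    using R that by (intro less psubset_card_mono fin words_above_trans) auto
  then obtain c where c: "\<And>v. v \<in> supp R \<Longrightarrow> lincomb f (c v) = word_poly v"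
    "\<And>v. v \<in> supp R \<Longrightarrow> unitri v (c v)"
    by metis
  have "lincomb (\<lambda>v. lincomb f (c v)) R = lincomb word_poly R"
    by (rule lincomb_cong) (simp_all add: c)
  then have "lincomb f (word_poly w - lincomb c R) = word_poly w"
    by (simp add: lincomb_lincomb R_def)
  moreover have "supp (lincomb c R) \<subseteq> words_above w"
    using supp_lincomb[of c R] supp_unitri[OF c(2)] R words_above_trans by blast
  then have "unitri w (word_poly w - lincomb c R)"
    by (simp add: unitri_def in_keys_iff subset_iff)
  ultimately show ?case
    by blast
qed

lemma unitri_span:
  fixes f :: "lword \<Rightarrow> 'k::comm_ring_1 ncpoly"
  assumes "\<And>w. unitri w (f w)"
  shows "\<exists>c. lincomb f c = P"
proof (induct P rule: poly_induct)
  case (word w)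
  then show ?case
    using unitri_inverse[of f w] assms by blast
next
  case (add P Q)
  then show ?case
    by (auto simp flip: lincomb_add)
next
  case (scale c P)
  then show ?case
    by (auto simp flip: lincomb_scale)
qed

text \<open>The least word of the support receives a contribution only from its own member of the
  family.\<close>

lemma unitri_indep:
  fixes f :: "lword \<Rightarrow> 'k::comm_ring_1 ncpoly"
  assumes tri: "\<And>w. unitri w (f w)" and 0: "lincomb f c = 0"
  shows "c = 0"
proof (rule ccontr)
  assume "c \<noteq> 0"
  then have ne: "supp c \<noteq> {}"
    by (metis keys_eq_empty)
  define w where "w = Min (supp c)"
  have w: "w \<in> supp c" "\<And>v. v \<in> supp c \<Longrightarrow> w \<le> v"
    using ne by (simp_all add: w_def)
  have coeff_f: "coeff (f v) w = (if v = w then 1 else 0)" if "w \<le> v" for v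
  proof -
    have "w \<notin> supp (f v - word_poly v)"
      using tri[of v] that by (auto simp: unitri_def words_above_def)
    then show ?thesis
      by (simp add: in_keys_iff lookup_minus lookup_single when_def)
  qed
  have "coeff (lincomb f c) w = (\<Sum>v\<in>supp c. if v = w then coeff c w else 0)"
    unfolding coeff_lincomb by (rule sum.cong) (auto simp: coeff_f w(2))
  also have "\<dots> = coeff c w"
    using w(1) by simp
  finally show False
    using 0 w(1) by (simp add: in_keys_iff)
qed

lemma unitri_pairing_eqI:
  assumes tri: "\<And>w. unitri w (f w)" and eq: "\<And>w. pairing P (f w) = pairing Q (f w)"
  shows "P = Q"
proof (rule poly_mapping_eqI)
  fix w
  obtain c where c: "lincomb f c = word_poly w"
    using unitri_span[of f] tri by blast
  have "coeff P w = ev (\<lambda>v. pairing P (f v)) c" for P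
  proof -
    have "coeff P w = pairing (lincomb f c) P"
      by (simp add: c)
    also have "\<dots> = ev (\<lambda>v. pairing (f v) P) c"
      by (rule pairing_lincomb)
    finally show ?thesis
      by (simp only: pairing_commute[of P])
  qed
  then show "coeff P w = coeff Q w"
    by (simp add: eq)
qed

text \<open>The dual family is the transpose of the inverse matrix \<open>c\<close>; it has finite
  support because \<open>c\<close> preserves weight.\<close>

lemma unitri_dual_exists:
  fixes f :: "lword \<Rightarrow> 'k::comm_ring_1 ncpoly"
  assumes tri: "\<And>w. unitri w (f w)"
  shows "\<exists>S. \<forall>u v. pairing (S v) (f u) = (if u = v then 1 else 0)"
proof -
  obtain c where c: "\<And>w. lincomb f (c w) = word_poly w" "\<And>w. unitri w (c w)"
    using unitri_inverse[of f] tri by metis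
  define S where "S v = (\<Sum>w | weight w = weight v. Poly_Mapping.single w (coeff (c w) v))" for v
  have S: "coeff (S v) w = coeff (c w) v" for v w
    using weight_supp_unitri[OF c(2)[of w], of v] finite_weight
    by (cases "coeff (c w) v = 0") (auto simp: S_def lookup_sum lookup_single when_def in_keys_iff)
  \<comment> \<open>\<open>c\<close> was built as a right inverse; that it is also a left inverse
    comes from the injectivity of \<open>lincomb f\<close>.\<close>
  have inv: "lincomb c (f u) = word_poly u" for u
  proof -
    have "lincomb f (lincomb c (f u) - word_poly u) = 0"
      by (simp add: lincomb_lincomb c(1))
    then have "lincomb c (f u) - word_poly u = 0"
      using tri by (rule unitri_indep[rotated])
    then show ?thesis
      by simp
  qed
  have "pairing (S v) (f u) = (if u = v then 1 else 0)" for u v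
  proof -
    have "pairing (S v) (f u) = ev (coeff (S v)) (f u)"
      by (subst pairing_commute) (rule pairing_eq_ev)
    also have "\<dots> = coeff (lincomb c (f u)) v"
      by (simp only: S coeff_lincomb_ev cong: ev_cong)
    finally show ?thesis
      by (simp add: inv lookup_single when_def)
  qed
  then show ?thesis
    by blast
qed

section \<open>Rational scalars\<close>

lemma scaleQ_mult_scaleQ: "(r *\<^sub>Q x) * (s *\<^sub>Q y) = (r * s) *\<^sub>Q (x * (y :: 'k::comm_rat_algebra_1))"
  by (metis mult.commute mult_scaleQ_left scaleQ_scaleQ)

lemma scaleQ_zero_left [simp]: "0 *\<^sub>Q (x :: 'k::comm_rat_algebra_1) = 0"
  using scaleQ_add_left[of 0 0 x] by simp

lemma scaleQ_zero_right [simp]: "r *\<^sub>Q (0 :: 'k::comm_rat_algebra_1) = 0"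
  using scaleQ_add_right[of r 0 0] by simp

lemma of_nat_scaleQ: "of_nat n *\<^sub>Q x = of_nat n * (x :: 'k::comm_rat_algebra_1)"
  by (induct n) (simp_all add: scaleQ_add_left scaleQ_one distrib_right)

lemma scaleQ_sum: "(\<Sum>i\<in>A. f i) *\<^sub>Q (x :: 'k::comm_rat_algebra_1) = (\<Sum>i\<in>A. f i *\<^sub>Q x)"
  by (induct A rule: infinite_finite_induct) (simp_all add: scaleQ_add_left)

lemma of_nat_inverse:
  assumes "0 < n"
  shows "of_nat n * (inverse (of_nat n) *\<^sub>Q 1) = (1 :: 'k::comm_rat_algebra_1)"
  using assms by (simp add: of_nat_scaleQ[symmetric] scaleQ_scaleQ scaleQ_one)

lemma of_nat_mult_eq_0:
  assumes "0 < n" "of_nat n * x = (0 :: 'k::comm_rat_algebra_1)"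
  shows "x = 0"
proof -
  have "x = (of_nat n * (inverse (of_nat n) *\<^sub>Q 1)) * x"
    using of_nat_inverse[OF assms(1), where 'k = 'k] by simp
  also have "\<dots> = (inverse (of_nat n) *\<^sub>Q 1) * (of_nat n * x)"
    by (simp only: ac_simps)
  finally show ?thesis
    using assms(2) by simp
qed

section \<open>The primitive polynomials associated with letters\<close>

text \<open>Pascal's rule under the sum; it serves as induction step both for finite differences and
  for counting the words of a \<open>q\<close>-stuffle product by length.\<close>

lemma sum_choose_Suc:
  fixes R :: "nat \<Rightarrow> 'a::comm_ring_1"
  shows "(\<Sum>j\<le>Suc n. of_nat (Suc n choose j) * R j) =
    (\<Sum>j\<le>n. of_nat (n choose j) * (R j + R (Suc j)))"
proof -
  have "(\<Sum>j\<le>Suc n. of_nat (Suc n choose j) * R j) =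
      R 0 + (\<Sum>j\<le>n. of_nat (n choose Suc j) * R (Suc j)) + (\<Sum>j\<le>n. of_nat (n choose j) * R (Suc j))"
    by (simp add: sum.atMost_Suc_shift sum.distrib distrib_right del: sum.atMost_Suc)
  also have "R 0 + (\<Sum>j\<le>n. of_nat (n choose Suc j) * R (Suc j)) =
      (\<Sum>j\<le>Suc n. of_nat (n choose j) * R j)"
    by (simp add: sum.atMost_Suc_shift del: sum.atMost_Suc)
  finally show ?thesis
    by (simp add: sum.distrib distrib_left binomial_eq_0)
qed

text \<open>The sum is an \<open>n\<close>-th finite difference of a polynomial of degree \<open>k < n\<close>.\<close>

lemma alternating_choose_sum:
  assumes "k < n"
  shows "(\<Sum>j\<le>n. of_nat (n choose j) * ((-1) ^ j * of_nat ((m + j) choose k))) = (0 :: 'a::comm_ring_1)"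
  using assms
proof (induct n arbitrary: k)
  case (Suc n)
  show ?case
  proof (cases k)
    case 0
    show ?thesis
      unfolding sum_choose_Suc by (simp add: 0)
  next
    case (Suc k')
    have "(-1) ^ j * of_nat ((m + j) choose k) + (-1) ^ Suc j * of_nat ((m + Suc j) choose k) =
        - ((-1) ^ j * (of_nat ((m + j) choose k') :: 'a))" for j
      by (simp add: Suc algebra_simps)
    with Suc.hyps[of k'] Suc.prems show ?thesis
      unfolding sum_choose_Suc by (simp add: Suc sum_negf)
  qed
qed simp

lemma ev_letter_mult [simp]: "ev f (word_poly [a] * P) = ev (\<lambda>w. f (a # w)) P"
  by (induct P rule: poly_induct) (simp_all add: mult_single distrib_left)

text \<open>A word of length \<open>length v + j\<close> in the product arises from
  \<open>length u - j\<close> mergers, each carrying a factor \<open>q\<close>. The two binomial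
  coefficients count the positions occupied by \<open>u\<close> and the choice of its
  \<open>j\<close> unmerged letters.\<close>

lemma ev_length_stuffle_word:
  fixes q :: "'k::comm_ring_1"
  shows "ev (\<lambda>w. g (length w)) (stuffle_word q u v) =
    (\<Sum>j\<le>length u. of_nat (length u choose j) *
      (of_nat ((length v + j) choose length u) * q ^ (length u - j) * g (length v + j)))"
proof (induct q u v arbitrary: g rule: stuffle_word.induct)
  case (2 q a u)
  let ?n = "length (a # u)"
  \<comment> \<open>With \<open>v\<close> empty nothing can merge: the second binomial coefficient
    vanishes unless \<open>j\<close> is the full length.\<close>
  have "(\<Sum>j\<le>?n. of_nat (?n choose j) * (of_nat ((0 + j) choose ?n) * q ^ (?n - j) * g (0 + j))) =
      (\<Sum>j\<le>?n. if j = ?n then g ?n else 0)"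
  proof (intro sum.cong refl)
    fix j
    assume "j \<in> {..?n}"
    then show "of_nat (?n choose j) * (of_nat ((0 + j) choose ?n) * q ^ (?n - j) * g (0 + j)) =
        (if j = ?n then g ?n else 0)"
      by (cases "j < ?n") (auto simp: binomial_eq_0)
  qed
  then show ?case
    by (simp del: sum.atMost_Suc binomial_Suc_Suc)
next
  case (3 q a u b v)
  define m n where "m = length u" and "n = length v"
  \<comment> \<open>\<open>R\<close> accounts for the words whose first letter involves
    \<open>a\<close>: standing alone it gives \<open>R (Suc j)\<close>, merged with \<open>b\<close>
    it gives \<open>R j\<close>, and \<open>sum_choose_Suc\<close> joins the two.\<close>
  define R where "R j = of_nat ((n + j) choose m) * q ^ (Suc m - j) * g (Suc n + j)" for j
  have IH: "ev (\<lambda>w. g (Suc (length w))) (stuffle_word q u (b # v)) =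
      (\<Sum>j\<le>m. of_nat (m choose j) * R (Suc j))"
    "ev (\<lambda>w. g (Suc (length w))) (stuffle_word q (a # u) v) =
      (\<Sum>j\<le>Suc m. of_nat (Suc m choose j) *
        (of_nat ((n + j) choose Suc m) * q ^ (Suc m - j) * g (Suc n + j)))"
    "q * ev (\<lambda>w. g (Suc (length w))) (stuffle_word q u v) = (\<Sum>j\<le>m. of_nat (m choose j) * R j)"
    using 3(1)[of "\<lambda>l. g (Suc l)"] 3(2)[of "\<lambda>l. g (Suc l)"] 3(3)[of "\<lambda>l. g (Suc l)"]
    by (simp_all add: m_def n_def R_def sum_distrib_left Suc_diff_le ac_simps
       del: sum.atMost_Suc binomial_Suc_Suc)
  have "ev (\<lambda>w. g (length w)) (stuffle_word q (a # u) (b # v)) =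
      (\<Sum>j\<le>Suc m. of_nat (Suc m choose j) * R j) +
      (\<Sum>j\<le>Suc m. of_nat (Suc m choose j) *
        (of_nat ((n + j) choose Suc m) * q ^ (Suc m - j) * g (Suc n + j)))"
    unfolding sum_choose_Suc[of _ R]
    by (simp add: IH distrib_left sum.distrib del: sum.atMost_Suc binomial_Suc_Suc)
  also have "\<dots> = (\<Sum>j\<le>Suc m. of_nat (Suc m choose j) *
        (of_nat ((Suc n + j) choose Suc m) * q ^ (Suc m - j) * g (Suc n + j)))"
    unfolding sum.distrib[symmetric]
    by (intro sum.cong refl) (simp add: R_def algebra_simps)
  finally show ?case
    by (simp add: m_def n_def del: sum.atMost_Suc binomial_Suc_Suc)
qed simp

text \<open>Dividing log (1 + q x) by \<open>q\<close> merely lowers the exponent of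
  \<open>q\<close>, so the formula makes sense for every \<open>q\<close>; for \<open>q = 0\<close>
  only the value 1 at \<open>r = 1\<close> remains.\<close>

definition log_coeff :: "'k::comm_rat_algebra_1 \<Rightarrow> nat \<Rightarrow> 'k" where
  "log_coeff q r = ((-1) ^ (r - 1) / of_nat r) *\<^sub>Q q ^ (r - 1)"

text \<open>
  The coefficients of \<open>x \<mapsto> log (1 + q x) / q\<close> turn \<open>x + y + q x y\<close> into a sum; on words
  this says that the functional depending on the length through them kills proper products.
\<close>

lemma ev_log_coeff_stuffle_word:
  assumes "u \<noteq> []" "v \<noteq> []"
  shows "ev (\<lambda>w. log_coeff q (length w)) (stuffle_word q u v) = 0"
proof -
  obtain m n where mn: "length u = Suc m" "length v = Suc n"
    using assms by (metis length_0_conv not0_implies_Suc)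
  have "of_nat (Suc m choose j) * (of_nat ((Suc n + j) choose Suc m) * q ^ (Suc m - j) *
        log_coeff q (Suc n + j)) =
      (of_nat (Suc m choose j) * ((-1) ^ j * of_nat ((n + j) choose m))) *\<^sub>Q
        (((-1) ^ n / of_nat (Suc m)) *\<^sub>Q q ^ (Suc m + n))" if "j \<le> Suc m" for j
  proof -
    \<comment> \<open>Absorption trades the denominator \<open>Suc n + j\<close>, which varies with
      \<open>j\<close>, for the constant \<open>Suc m\<close>. What then varies with
      \<open>j\<close> is a polynomial of degree \<open>m\<close> with alternating sign, which a
      finite difference of order \<open>Suc m\<close> annihilates.\<close>
    have frac: "of_nat ((Suc n + j) choose Suc m) / (of_nat (Suc n + j) :: rat) =
        of_nat ((n + j) choose m) / of_nat (Suc m)"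
    proof -
      have "Suc m * ((Suc n + j) choose Suc m) = Suc (n + j) * ((n + j) choose m)"
        using Suc_times_binomial_eq[of "n + j" m] by (simp add: ac_simps del: binomial_Suc_Suc)
      then have "(of_nat (Suc m) :: rat) * of_nat ((Suc n + j) choose Suc m) =
          of_nat (Suc (n + j)) * of_nat ((n + j) choose m)"
        by (simp only: of_nat_mult[symmetric])
      then show ?thesis
        by (simp add: field_simps del: of_nat_Suc binomial_Suc_Suc)
    qed
    have *: "of_nat ((Suc n + j) choose Suc m) * ((-1) ^ (n + j) / (of_nat (Suc n + j) :: rat)) =
        (-1) ^ j * of_nat ((n + j) choose m) * ((-1) ^ n / of_nat (Suc m))"
    proof -
      have "of_nat ((Suc n + j) choose Suc m) * ((-1) ^ (n + j) / (of_nat (Suc n + j) :: rat)) =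
          (-1) ^ (n + j) * (of_nat ((Suc n + j) choose Suc m) / of_nat (Suc n + j))"
        by (simp only: times_divide_eq_right mult.commute)
      also have "\<dots> = (-1) ^ (n + j) * (of_nat ((n + j) choose m) / of_nat (Suc m))"
        by (simp only: frac)
      finally show ?thesis
        by (simp only: power_add times_divide_eq_right ac_simps)
    qed
    have "q ^ (Suc m - j) * q ^ (n + j) = q ^ (Suc m + n)"
      using that by (simp add: power_add[symmetric])
    moreover have "of_nat (Suc m choose j) * (of_nat ((Suc n + j) choose Suc m) * q ^ (Suc m - j) *
        log_coeff q (Suc n + j)) =
        (of_nat (Suc m choose j) * (of_nat ((Suc n + j) choose Suc m) *
          ((-1) ^ (n + j) / of_nat (Suc n + j)))) *\<^sub>Q (q ^ (Suc m - j) * q ^ (n + j))"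
    proof -
      have "of_nat (Suc m choose j) * (of_nat ((Suc n + j) choose Suc m) * q ^ (Suc m - j) *
          log_coeff q (Suc n + j)) =
          (of_nat (Suc m choose j) *\<^sub>Q 1) * ((of_nat ((Suc n + j) choose Suc m) *\<^sub>Q 1) *
            (1 *\<^sub>Q q ^ (Suc m - j)) * (((-1) ^ (n + j) / of_nat (Suc n + j)) *\<^sub>Q q ^ (n + j)))"
        by (simp add: log_coeff_def of_nat_scaleQ scaleQ_one del: of_nat_Suc binomial_Suc_Suc)
      then show ?thesis
        by (simp only: scaleQ_mult_scaleQ mult_1_right mult_1_left mult.assoc)
    qed
    ultimately show ?thesis
      by (simp only: * scaleQ_scaleQ mult.assoc)
  qed
  then have "ev (\<lambda>w. log_coeff q (length w)) (stuffle_word q u v) =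
      (\<Sum>j\<le>Suc m. (of_nat (Suc m choose j) * ((-1) ^ j * of_nat ((n + j) choose m))) *\<^sub>Q
        (((-1) ^ n / of_nat (Suc m)) *\<^sub>Q q ^ (Suc m + n)))"
    unfolding ev_length_stuffle_word mn by (intro sum.cong) simp_all
  also have "\<dots> = 0"
    unfolding scaleQ_sum[symmetric] by (subst alternating_choose_sum) simp_all
  finally show ?thesis .
qed

section \<open>Coefficients of \<open>pi1\<close> at a letter\<close>

lemma coeff_stuffle_word_left:
  "coeff (stuffle q (word_poly u) X) w = ev (\<lambda>v. coeff (coproduct q (word_poly w)) (u, v)) X"
  by (simp add: stuffle_eq_lincomb coeff_lincomb_ev coeff_stuffle_word)

lemma coeff_stuffle_word_left_Nil:
  "u \<noteq> [] \<Longrightarrow> coeff (stuffle q (word_poly u) X) [] = 0"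
  by (simp add: coeff_stuffle_word_left lookup_one when_def ev_def)

text \<open>Words of a product are at least as long as each factor, so \<open>u\<close> must be a
  letter. Either it survives against the constant term of \<open>X\<close>, or it merges with the
  letter of complementary index.\<close>

lemma coeff_stuffle_word_left_letter:
  assumes "u \<noteq> []"
  shows "coeff (stuffle q (word_poly u) X) [a] =
    (if \<exists>b. u = [b] \<and> index b \<le> index a
     then if u = [a] then coeff X [] else q * coeff X [letter (index a - index (hd u))] else 0)"
proof -
  obtain b u' where u: "u = b # u'"
    using assms by (cases u) auto
  have "coeff (coproduct q (word_poly [a])) (u, v) =
      (if u' = [] \<and> a = b then if v = [] then 1 else 0
       else if u' = [] \<and> index b < index a then
         q * (if v = [letter (index a - index b)] then 1 else 0) else 0)" for v
  proof -
    have coeff: "coeff (coproduct q (word_poly [a])) (u, v) =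
        (if u' = [] \<and> a = b \<and> v = [] then 1 else 0) +
        (case v of [] \<Rightarrow> 0 | x # v' \<Rightarrow>
          if index a = index b + index x then if u' = [] \<and> v' = [] then q else 0 else 0)"
      using coeff_coproduct_letter_mult[of q a 1 u v]
      by (simp add: coproduct_word lookup_one when_def u split: list.split)
    show ?thesis
    proof (cases v)
      case (Cons x v')
      show ?thesis
      proof (cases "index a = index b + index x")
        case True
        then have "index b < index a" "a \<noteq> b" "letter (index a - index b) = x"
          using index_ge_1[of x] by (auto simp: letter_eq_iff)
        with True show ?thesis
          unfolding coeff unfolding Cons by simp
      next
        case False
        then have "\<not> (index b < index a \<and> x = letter (index a - index b))"
          by (auto simp: letter_eq_iff)
        with False show ?thesis
          unfolding coeff by (simp add: Cons)
      qed
    next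
      case Nil
      show ?thesis
        unfolding coeff unfolding Nil by simp
    qed
  qed
  then have "coeff (stuffle q (word_poly u) X) [a] =
      ev (\<lambda>v. (if u' = [] \<and> a = b then if v = [] then 1 else 0
       else if u' = [] \<and> index b < index a then
         q * (if v = [letter (index a - index b)] then 1 else 0) else 0)) X"
    by (simp only: coeff_stuffle_word_left)
  also have "\<dots> = (if u' = [] \<and> a = b then coeff X []
       else if u' = [] \<and> index b < index a then
         q * coeff X [letter (index a - index b)] else 0)"
    unfolding coeff_eq_ev
    by (cases "u' = []"; cases "a = b"; cases "index b < index a") (simp_all add: ev_fun_mult)
  finally show ?thesis
    using u by (auto simp: letter_eq_iff)
qed

lemma coeff_foldr_stuffle_Nil:
  "[] \<notin> set us \<Longrightarrow>
    coeff (foldr (\<lambda>u. stuffle q (word_poly u)) us 1) [] = (if us = [] then 1 else 0)"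
  by (cases us) (auto simp: coeff_stuffle_word_left_Nil coeff_one_list)

text \<open>Only letters can produce a letter, and they do so in exactly one way, through
  \<open>length us - 1\<close> mergers.\<close>

lemma coeff_foldr_stuffle_letter:
  assumes "[] \<notin> set us"
  shows "coeff (foldr (\<lambda>u. stuffle q (word_poly u)) us 1) [a] =
    (if (\<forall>u\<in>set us. length u = 1) \<and> weight (concat us) = index a then q ^ (length us - 1) else 0)"
  using assms
proof (induct us arbitrary: a)
  case Nil
  then show ?case
    using index_ge_1[of a] by (simp add: coeff_one_list)
next
  case (Cons u us)
  show ?case
  proof (cases "\<exists>b. u = [b] \<and> index b \<le> index a")
    case True
    then obtain b where b: "u = [b]" "index b \<le> index a"
      by auto
    show ?thesis
    proof (cases "b = a")
      case True
      have "us \<noteq> [] \<Longrightarrow> weight (concat us) \<noteq> 0"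
        using Cons(2) by (cases us) auto
      then show ?thesis
        using True Cons(2) b
        by (auto simp: coeff_stuffle_word_left_letter coeff_foldr_stuffle_Nil)
    next
      case False
      with b have less: "index b < index a"
        by (auto simp: letter_eq_iff)
      have "us \<noteq> []" if "weight (concat us) = index a - index b"
        using that less by auto
      then show ?thesis
        using Cons b False less
        by (auto simp: coeff_stuffle_word_left_letter power_Suc[symmetric]
            simp del: power_Suc)
    qed
  next
    case False
    then show ?thesis
      using Cons(2) by (auto simp: coeff_stuffle_word_left_letter length_Suc_conv)
  qed
qed

lemma log_coeff_1 [simp]: "log_coeff q 1 = 1"
  by (simp add: log_coeff_def scaleQ_one)

text \<open>The contributing lists \<open>us\<close> consist of one-letter words, so they amount to
  words of weight \<open>index a\<close>, and the defining sum becomes a finite sum over these.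
  Length one is supplied by the leading term of \<open>pi1\<close>.\<close>

lemma coeff_pi1_letter:
  "coeff (pi1 q [a]) w = (if weight w = index a then log_coeff q (length w) else 0)"
proof -
  let ?s = "map (\<lambda>x :: letter. [x])"
  define g where "g us = ((let k = length us;
            c = coeff (foldr (\<lambda>u. stuffle q (word_poly u)) us 1) [a]
        in scale (((-1) ^ (k - 1) / of_nat k) *\<^sub>Q c) (word_poly (concat us)))
       when 2 \<le> length us \<and> [] \<notin> set us)" for us :: "lword list"
  have g_s: "g (?s v) = (if weight v = index a \<and> 2 \<le> length v
      then scale (log_coeff q (length v)) (word_poly v) else 0)" for v
  proof -
    have "[] \<notin> set (?s v)"
      by auto
    then show ?thesis
      by (auto simp: g_def coeff_foldr_stuffle_letter log_coeff_def Let_def simp del: scale_single)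
  qed
  have singletons: "?s (concat us) = us" if "\<forall>u\<in>set us. length u = 1" for us :: "lword list"
    using that by (induct us) (auto simp: length_Suc_conv)
  have "us \<in> ?s ` {v. weight v = index a}" if "g us \<noteq> 0" for us
  proof -
    have "(\<forall>u\<in>set us. length u = 1) \<and> weight (concat us) = index a"
      using that by (auto simp: g_def coeff_foldr_stuffle_letter Let_def split: if_splits)
    then show ?thesis
      by (intro image_eqI[of _ _ "concat us"]) (simp_all add: singletons)
  qed
  then have "{us. g us \<noteq> 0} \<subseteq> ?s ` {v. weight v = index a}"
    by blast
  then have "Sum_any g = sum g (?s ` {v. weight v = index a})"
    by (intro Sum_any.expand_superset) (simp_all add: finite_weight)
  also have "\<dots> = (\<Sum>v | weight v = index a. g (?s v))"
    by (subst sum.reindex) (auto simp: inj_on_def)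
  finally have "Sum_any g = \<dots>" .
  moreover have "pi1 q [a] = word_poly [a] + Sum_any g"
    by (simp only: pi1_def g_def[abs_def])
  ultimately have "coeff (pi1 q [a]) w =
      coeff (word_poly [a]) w + (\<Sum>v | weight v = index a. coeff (g (?s v)) w)"
    by (simp add: lookup_add lookup_sum)
  also have "(\<Sum>v | weight v = index a. coeff (g (?s v)) w) =
      (\<Sum>v | weight v = index a. if v = w then if 2 \<le> length v then log_coeff q (length v) else 0 else 0)"
    by (intro sum.cong) (auto simp: g_s lookup_single when_def)
  also have "\<dots> = (if weight w = index a \<and> 2 \<le> length w then log_coeff q (length w) else 0)"
    by (simp add: finite_weight)
  finally show ?thesis
    using index_ge_1[of a] log_coeff_1[of q]
    by (cases w rule: remdups_adj.cases) (auto simp: lookup_single when_def letter_eq_iff)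
qed

text \<open>At a pair of nonempty words the coproduct is the logarithmic functional evaluated on
  their product. By homogeneity the restriction to weight \<open>index a\<close> comes out as a
  constant factor.\<close>

lemma pi1_letter_primitive: "pi1 q [a] \<in> primitives q"
proof -
  let ?P = "pi1 q [a]"
  have Nil: "coeff ?P [] = 0"
    using index_ge_1[of a] by (simp add: coeff_pi1_letter)
  have "coeff (coproduct q ?P) (u, v) = coeff (tensor ?P 1 + tensor 1 ?P) (u, v)" for u v
  proof (cases "u = [] \<or> v = []")
    case True
    then show ?thesis
      by (auto simp: coeff_coproduct lookup_add coeff_tensor coeff_one_list Nil)
  next
    case False
    have "coeff (coproduct q ?P) (u, v) =
        ev (\<lambda>w. (if weight u + weight v = index a then 1 else 0) * log_coeff q (length w))
          (stuffle_word q u v)"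
      unfolding coeff_coproduct by (rule ev_cong) (auto simp: coeff_pi1_letter weight_stuffle_word)
    also have "\<dots> = 0"
      unfolding ev_fun_mult using False by (simp add: ev_log_coeff_stuffle_word)
    finally show ?thesis
      using False by (simp add: lookup_add coeff_tensor coeff_one_list)
  qed
  then have "coproduct q ?P = tensor ?P 1 + tensor 1 ?P"
    by (intro poly_mapping_eqI) (metis surj_pair)
  then show ?thesis
    by (simp add: primitives_def)
qed

text \<open>A longer word of the same weight starts with a smaller index, and the reversed order of
  the alphabet makes that a larger letter.\<close>

lemma unitri_pi1_letter: "unitri [a] (pi1 q [a])"
  unfolding unitri_def
proof
  fix v
  assume "v \<in> supp (pi1 q [a] - word_poly [a])"
  then have v: "weight v = index a" "v \<noteq> [a]"
    using log_coeff_1[of q]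
    by (auto simp: in_keys_iff lookup_minus coeff_pi1_letter lookup_single when_def split: if_splits)
  then obtain b v' where v': "v = b # v'"
    using index_ge_1[of a] by (cases v) auto
  with v have "v' \<noteq> []"
    by (auto simp: letter_eq_iff)
  then have "0 < weight v'"
    using weight_eq_0_iff[of v'] by blast
  with v v' show "v \<in> words_above [a]"
    by (simp add: words_above_def less_letter_def)
qed

section \<open>The family of Lyndon commutators\<close>

lemma Pi_lyndon_letter: "Pi_lyndon q [a] = pi1 q [a]"
  by (subst Pi_lyndon.simps) simp

lemma Pi_lyndon_commutator:
  "2 \<le> length l \<Longrightarrow> Pi_lyndon q l =
     Pi_lyndon q (std_left l) * Pi_lyndon q (std_right l) -
     Pi_lyndon q (std_right l) * Pi_lyndon q (std_left l)"
  by (subst Pi_lyndon.simps) simp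

lemma lyndon_induct [consumes 1, case_names letter std]:
  assumes "lyndon l"
    and letter: "\<And>a. A [a]"
    and std: "\<And>l. lyndon l \<Longrightarrow> 2 \<le> length l \<Longrightarrow> A (std_left l) \<Longrightarrow> A (std_right l) \<Longrightarrow> A l"
  shows "A l"
  using assms(1)
proof (induct "length l" arbitrary: l rule: less_induct)
  case less
  show ?case
  proof (cases "2 \<le> length l")
    case True
    then have A: "A (std_left l)" "A (std_right l)"
      using less(2) lyndon_std_left[of l] std_right(2)[of l]
      by (auto intro!: less(1) length_std_left length_std_right)
    show ?thesis
      by (rule std[OF less(2) True A])
  next
    case False
    with less(2) obtain a where "l = [a]"
      by (cases l rule: remdups_adj.cases) auto
    then show ?thesis
      by (simp add: letter)
  qed
qed

text \<open>The subtracted product has leading word \<open>r @ s\<close>, which lies above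
  \<open>l = s @ r\<close> because \<open>l < r \<le> r @ s\<close>.\<close>

lemma unitri_Pi_lyndon: "lyndon l \<Longrightarrow> unitri l (Pi_lyndon q l)"
proof (induct rule: lyndon_induct)
  case (letter a)
  show ?case
    by (simp add: Pi_lyndon_letter unitri_pi1_letter)
next
  case (std l)
  let ?s = "std_left l" and ?r = "std_right l"
  have l: "?s @ ?r = l"
    using std by (intro std_left_append_std_right)
  have ne: "?s \<noteq> []" "?r \<noteq> []"
    using lyndon_std_left[OF std(1,2)] std_right(2)[OF std(2)] by auto
  have "unitri l (Pi_lyndon q ?s * Pi_lyndon q ?r)"
    using unitri_mult[OF std(3,4)] by (simp add: l)
  moreover have "l < ?r @ ?s"
    by (rule order.strict_trans2[OF lyndonD[OF std(1) l[symmetric] ne] le_append])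
  moreover have "weight l = weight (?r @ ?s)"
    using arg_cong[OF l, of weight] by simp
  moreover have "unitri (?r @ ?s) (Pi_lyndon q ?r * Pi_lyndon q ?s)"
    using unitri_mult[OF std(4,3)] .
  then have "supp (Pi_lyndon q ?r * Pi_lyndon q ?s) \<subseteq> insert (?r @ ?s) (words_above (?r @ ?s))"
    by (rule supp_unitri)
  ultimately have "unitri l (Pi_lyndon q ?s * Pi_lyndon q ?r)"
    "supp (Pi_lyndon q ?r * Pi_lyndon q ?s) \<subseteq> words_above l"
    by (auto simp: words_above_def)
  then have "supp (Pi_lyndon q ?s * Pi_lyndon q ?r - word_poly l) \<union>
      supp (Pi_lyndon q ?r * Pi_lyndon q ?s) \<subseteq> words_above l"
    by (simp add: unitri_def)
  moreover have "Pi_lyndon q l - word_poly l =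
      (Pi_lyndon q ?s * Pi_lyndon q ?r - word_poly l) - Pi_lyndon q ?r * Pi_lyndon q ?s"
    by (simp add: Pi_lyndon_commutator[OF std(2)])
  ultimately show ?case
    unfolding unitri_def by (simp only: order_trans[OF keys_diff])
qed

lemma unitri_Pi_family: "unitri w (Pi_family q w)"
proof -
  have "unitri (concat ls) (prod_list (map (Pi_lyndon q) ls))" if "\<forall>l\<in>set ls. lyndon l" for ls
    using that
  proof (induct ls)
    case Nil
    then show ?case
      by (simp add: unitri_def)
  qed (simp add: unitri_mult unitri_Pi_lyndon)
  from this[of "lfac w"] show ?thesis
    using lfac[of w] by (simp add: Pi_family_eq lyndon_list_def)
qed

lemma Pi_family_lyndon: "lyndon l \<Longrightarrow> Pi_family q l = Pi_lyndon q l"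
  by (simp add: Pi_family_eq lfac_lyndon)

lemma Pi_family_Nil [simp]: "Pi_family q [] = 1"
  by (simp add: Pi_family_eq)

text \<open>The mixed terms, \<open>P\<close> tensor \<open>Q\<close> and \<open>Q\<close> tensor
  \<open>P\<close>, are the same for both products and cancel.\<close>

lemma primitives_commutator:
  assumes "P \<in> primitives q" "Q \<in> primitives q"
  shows "P * Q - Q * P \<in> primitives q"
  using assms by (simp add: primitives_def coproduct_mult algebra_simps tensor_mult)

lemma Pi_lyndon_primitive: "lyndon l \<Longrightarrow> Pi_lyndon q l \<in> primitives q"
proof (induct rule: lyndon_induct)
  case (std l)
  then show ?case
    by (subst Pi_lyndon_commutator) (simp_all add: primitives_commutator)
qed (simp add: Pi_lyndon_letter pi1_letter_primitive)

lemma subspace_primitives: "poly.subspace (primitives q)"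
  by (rule poly.subspaceI)
    (simp_all add: primitives_def coproduct_eq_lincomb algebra_simps)

section \<open>Coproducts of products of primitive polynomials\<close>

text \<open>Pairs of complementary subsequences, kept in a list since equal factors produce the same
  pair several times; the repetitions become the multiplicities in the dual product.\<close>

fun splits :: "'a list \<Rightarrow> ('a list \<times> 'a list) list" where
  "splits [] = [([], [])]"
| "splits (l # ls) =
     map (\<lambda>(xs, ys). (l # xs, ys)) (splits ls) @ map (\<lambda>(xs, ys). (xs, l # ys)) (splits ls)"

lemma mset_splits: "(xs, ys) \<in> set (splits ls) \<Longrightarrow> mset xs + mset ys = mset ls"
  by (induct ls arbitrary: xs ys) auto

lemma splits_exists:
  "A + B = mset ls \<Longrightarrow> \<exists>(xs, ys)\<in>set (splits ls). mset xs = A \<and> mset ys = B"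
proof (induct ls arbitrary: A B)
  case (Cons l ls)
  then have "l \<in># A + B"
    by simp
  then consider A' where "A = add_mset l A'" | B' where "B = add_mset l B'"
    by (auto dest: multi_member_split)
  then show ?case
  proof cases
    case 1
    with Cons(2) have "A' + B = mset ls"
      by simp
    from Cons(1)[OF this] show ?thesis
      using 1 by force
  next
    case 2
    with Cons(2) have "A + B' = mset ls"
      by simp
    from Cons(1)[OF this] show ?thesis
      using 2 by force
  qed
qed simp

text \<open>Subsequences of a nonincreasing list are nonincreasing, so the products arising in the
  coproduct are members of \<open>Pi_family\<close> without any reordering.\<close>

lemma lyndon_list_splits:
  assumes "lyndon_list ls" "(xs, ys) \<in> set (splits ls)"
  shows "lyndon_list xs \<and> lyndon_list ys"
  using assms
proof (induct ls arbitrary: xs ys)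
  case (Cons l ls)
  have sub: "set xs \<subseteq> set ls" "set ys \<subseteq> set ls" if "(xs, ys) \<in> set (splits ls)" for xs ys
    using arg_cong[OF mset_splits[OF that], of set_mset] by auto
  from Cons(3) consider
      (left) xs' where "xs = l # xs'" "(xs', ys) \<in> set (splits ls)"
    | (right) ys' where "ys = l # ys'" "(xs, ys') \<in> set (splits ls)"
    by auto
  then show ?case
  proof cases
    case left
    with Cons(1)[OF _ left(2)] Cons(2) sub[OF left(2)] show ?thesis
      by (auto simp: lyndon_list_Cons)
  next
    case right
    with Cons(1)[OF _ right(2)] Cons(2) sub[OF right(2)] show ?thesis
      by (auto simp: lyndon_list_Cons)
  qed
qed simp

lemma prod_list_primitive:
  "prod_list (map (\<lambda>l. tensor (f l) 1 + tensor 1 (f l)) ls) =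
    (\<Sum>(xs, ys)\<leftarrow>splits ls. tensor (prod_list (map f xs)) (prod_list (map f ys)))"
  by (induct ls)
    (simp_all add: distrib_right case_prod_unfold comp_def tensor_mult sum_list_const_mult[symmetric]
      sum_list_addf)

lemma coproduct_Pi_family:
  "coproduct q (Pi_family q w) =
    (\<Sum>(xs, ys)\<leftarrow>splits (lfac w). tensor (Pi_family q (concat xs)) (Pi_family q (concat ys)))"
proof -
  have "coproduct q (prod_list (map f ls)) = prod_list (map (\<lambda>l. coproduct q (f l)) ls)" for f ls
    by (induct ls) (simp_all add: coproduct_mult)
  then have "coproduct q (Pi_family q w) =
      prod_list (map (\<lambda>l. coproduct q (Pi_lyndon q l)) (lfac w))"
    by (simp add: Pi_family_eq)
  also have "\<dots> = prod_list (map (\<lambda>l. tensor (Pi_lyndon q l) 1 + tensor 1 (Pi_lyndon q l)) (lfac w))"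
    using Pi_lyndon_primitive[of _ q] lfac(1)[of w]
    by (intro arg_cong[of _ _ prod_list] map_cong) (auto simp: lyndon_list_def primitives_def)
  also have "\<dots> = (\<Sum>(xs, ys)\<leftarrow>splits (lfac w).
      tensor (prod_list (map (Pi_lyndon q) xs)) (prod_list (map (Pi_lyndon q) ys)))"
    by (rule prod_list_primitive)
  also have "\<dots> = (\<Sum>(xs, ys)\<leftarrow>splits (lfac w).
      tensor (Pi_family q (concat xs)) (Pi_family q (concat ys)))"
    using lyndon_list_splits[OF lfac(1)[of w]]
    by (intro arg_cong[of _ _ sum_list] map_cong) (auto simp: Pi_family_eq lfac_concat)
  finally show ?thesis .
qed

section \<open>The dual family\<close>

lemma Pi_pairing_eqI:
  "(\<And>w. pairing P (Pi_family q w) = pairing Q (Pi_family q w)) \<Longrightarrow> P = Q"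
  by (rule unitri_pairing_eqI[of "Pi_family q"]) (simp_all add: unitri_Pi_family)

lemma pairing_Sigma_Pi: "pairing (Sigma_family q v) (Pi_family q u) = (if u = v then 1 else 0)"
proof -
  have "\<exists>!S. \<forall>u v. pairing (S v) (Pi_family q u) = (if u = v then 1 else 0)"
  proof (rule ex_ex1I)
    show "\<exists>S. \<forall>u v. pairing (S v) (Pi_family q u) = (if u = v then 1 else 0)"
      by (rule unitri_dual_exists) (rule unitri_Pi_family)
    show "S = S'" if "\<forall>u v. pairing (S v) (Pi_family q u) = (if u = v then 1 else 0)"
      "\<forall>u v. pairing (S' v) (Pi_family q u) = (if u = v then 1 else 0)" for S S'
      by (rule ext, rule Pi_pairing_eqI[of _ q]) (simp add: that)
  qed
  from theI'[OF this] show ?thesis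
    by (simp add: Sigma_family_def)
qed

lemma pairing_lincomb_Sigma: "pairing (lincomb (Sigma_family q) c) (Pi_family q u) = coeff c u"
  unfolding pairing_lincomb pairing_Sigma_Pi coeff_eq_ev[of c u] by (rule ev_cong) auto

lemma pairing_Sigma_lincomb: "pairing (Sigma_family q v) (lincomb (Pi_family q) c) = coeff c v"
  unfolding pairing_commute[of "Sigma_family q v"] pairing_lincomb coeff_eq_ev[of c v]
  by (rule ev_cong) (simp_all add: pairing_commute[of _ "Sigma_family q v"] pairing_Sigma_Pi)

lemma Sigma_family_Nil [simp]: "Sigma_family q [] = 1"
proof (rule Pi_pairing_eqI)
  fix w
  have "coeff (Pi_family q w) [] = (if w = [] then 1 else 0)"
    using weight_supp_unitri[OF unitri_Pi_family, of "[]" q w]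
    by (cases "w = []") (auto simp: coeff_one_list in_keys_iff)
  then show "pairing (Sigma_family q []) (Pi_family q w) = pairing 1 (Pi_family q w)"
    by (simp add: pairing_Sigma_Pi pairing_eq_ev[of 1])
qed

lemma basis_Pi: "is_basis UNIV (Pi_family q) UNIV"
  using unitri_indep[of "Pi_family q"] unitri_span[of "Pi_family q"] unitri_Pi_family
  by (intro is_basisI) auto

text \<open>By duality the coefficient of \<open>\<Sigma>_v\<close> in a word \<open>w\<close> is
  that of \<open>w\<close> in \<open>\<Pi>_v\<close>; homogeneity leaves finitely many
  \<open>v\<close>.\<close>

lemma Sigma_span: "\<exists>c. lincomb (Sigma_family q) c = P"
proof (induct P rule: poly_induct)
  case (word w)
  define c where "c = (\<Sum>v | weight v = weight w. Poly_Mapping.single v (coeff (Pi_family q v) w))"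
  have c: "coeff c v = coeff (Pi_family q v) w" for v
    using weight_supp_unitri[OF unitri_Pi_family[of v q], of w] finite_weight
    by (cases "coeff (Pi_family q v) w = 0")
      (auto simp: c_def lookup_sum lookup_single when_def in_keys_iff)
  have "lincomb (Sigma_family q) c = word_poly w"
    by (rule Pi_pairing_eqI[of _ q]) (simp add: pairing_lincomb_Sigma c)
  then show ?case
    by blast
next
  case (add P Q)
  then show ?case
    by (auto simp flip: lincomb_add)
next
  case (scale c P)
  then show ?case
    by (auto simp flip: lincomb_scale)
qed

lemma Sigma_indep: "lincomb (Sigma_family q) c = 0 \<Longrightarrow> c = 0"
  using pairing_lincomb_Sigma[of q c] by (intro poly_mapping_eqI) (simp add: pairing_eq_ev)

lemma basis_Sigma: "is_basis UNIV (Sigma_family q) UNIV"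
  using Sigma_indep[of q] Sigma_span[of q] by (intro is_basisI) auto

definition pairing2 :: "'k::comm_ring_1 ncpoly \<Rightarrow> 'k ncpoly \<Rightarrow> 'k ncpoly2 \<Rightarrow> 'k" where
  "pairing2 A B X = ev (\<lambda>u. ev (\<lambda>v. coeff X (u, v)) B) A"

lemma pairing2_add: "pairing2 A B (X + Y) = pairing2 A B X + pairing2 A B Y"
  by (simp add: pairing2_def lookup_add ev_fun_add)

lemma pairing2_zero: "pairing2 A B 0 = 0"
  by (simp add: pairing2_def)

lemma pairing2_tensor: "pairing2 A B (tensor P Q) = pairing A P * pairing B Q"
  by (simp add: pairing2_def coeff_tensor ev_fun_mult pairing_eq_ev mult.commute[of _ "ev _ B"])

lemma pairing2_sum_list:
  "pairing2 A B (\<Sum>x\<leftarrow>xs. f x) = (\<Sum>x\<leftarrow>xs. pairing2 A B (f x))"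
  by (induct xs) (simp_all add: pairing2_add pairing2_zero)

text \<open>The integer counts the ways of choosing positions for the factors of \<open>x\<close>
  among those of \<open>w\<close>, a product of binomial coefficients; it is positive as soon as one
  choice exists.\<close>

lemma stuffle_Sigma:
  assumes "lmset w = lmset x + lmset y"
  shows "\<exists>n>0. stuffle q (Sigma_family q x) (Sigma_family q y) = scale (of_nat n) (Sigma_family q w)"
proof -
  define N where "N t = length (filter (\<lambda>(xs, ys). concat xs = x \<and> concat ys = y) (splits (lfac t)))"
    for t
  \<comment> \<open>A splitting preserves the multiset of factors, so \<open>x\<close> and
    \<open>y\<close> arise from no other word.\<close>
  have N0: "N t = 0" if "t \<noteq> w" for t
  proof -
    have False if p: "(xs, ys) \<in> set (splits (lfac t))" "concat xs = x" "concat ys = y" for xs ys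
    proof -
      have "lmset x + lmset y = lmset t"
        using mset_splits[OF p(1)] lyndon_list_splits[OF lfac(1) p(1)]
        by (simp add: p(2,3)[symmetric] lmset_concat lmset_def[of t])
      with assms \<open>t \<noteq> w\<close> show False
        by (simp add: lmset_inject)
    qed
    then show ?thesis
      by (auto simp: N_def filter_empty_conv)
  qed
  obtain xs ys where xy: "(xs, ys) \<in> set (splits (lfac w))" "mset xs = lmset x" "mset ys = lmset y"
    using splits_exists[of "lmset x" "lmset y" "lfac w"] assms by (auto simp: lmset_def)
  have "lmset (concat xs) = lmset x" "lmset (concat ys) = lmset y"
    using xy(2,3) lyndon_list_splits[OF lfac(1) xy(1)] by (simp_all add: lmset_concat)
  then have "concat xs = x" "concat ys = y"
    by (simp_all add: lmset_inject)
  with xy(1) have "0 < N w"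
    unfolding N_def by (auto simp: length_pos_if_in_set filter_empty_conv)
  moreover have "stuffle q (Sigma_family q x) (Sigma_family q y) = scale (of_nat (N w)) (Sigma_family q w)"
  proof (rule Pi_pairing_eqI)
    fix t
    have "pairing (stuffle q (Sigma_family q x) (Sigma_family q y)) (Pi_family q t) =
        pairing2 (Sigma_family q x) (Sigma_family q y) (coproduct q (Pi_family q t))"
      by (simp add: pairing_stuffle pairing2_def)
    also have "\<dots> = (\<Sum>(xs, ys)\<leftarrow>splits (lfac t). if concat xs = x \<and> concat ys = y then 1 else 0)"
      unfolding coproduct_Pi_family pairing2_sum_list
      by (intro arg_cong[of _ _ sum_list] map_cong)
        (auto simp: pairing2_tensor pairing_Sigma_Pi)
    also have "\<dots> = of_nat (N t)"
    proof -
      have "(\<Sum>p\<leftarrow>ps. if P p then 1 else 0) = (of_nat (length (filter P ps)) :: 'a)"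
        for P and ps :: "(lword list \<times> lword list) list"
        by (induct ps) simp_all
      then show ?thesis
        by (simp add: N_def case_prod_unfold)
    qed
    finally show "pairing (stuffle q (Sigma_family q x) (Sigma_family q y)) (Pi_family q t) =
        pairing (scale (of_nat (N w)) (Sigma_family q w)) (Pi_family q t)"
      using N0[of t] by (auto simp: pairing_Sigma_Pi)
  qed
  ultimately show ?thesis
    by blast
qed

section \<open>Primitive polynomials\<close>

lemma pairing_stuffle_primitive:
  assumes "P \<in> primitives q"
  shows "pairing (stuffle q A B) P = pairing A P * pairing B 1 + pairing A 1 * pairing B P"
  using assms
  by (simp add: primitives_def pairing_stuffle pairing2_def[symmetric] pairing2_add pairing2_tensor)

text \<open>For nonempty \<open>w\<close>, splitting off the first Lyndon factor exhibits a positive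
  multiple of \<open>\<Sigma>_w\<close> as a product of two members orthogonal to 1, and such a
  product is orthogonal to primitive polynomials.\<close>

lemma pairing_Sigma_primitive:
  assumes P: "P \<in> primitives q" and w: "\<not> lyndon w"
  shows "pairing (Sigma_family q w) P = (0 :: 'k::comm_rat_algebra_1)"
proof (cases "w = []")
  case True
  \<comment> \<open>At the pair of empty words, primitivity says that the constant term equals twice
    itself.\<close>
  have "coeff (coproduct q P) ([], []) = coeff (tensor P 1 + tensor 1 P) ([], [])"
    using P by (simp add: primitives_def)
  then have "coeff P [] = 0"
    by (simp add: coeff_coproduct lookup_add coeff_tensor coeff_one_list)
  with True show ?thesis
    by (simp add: pairing_eq_ev)
next
  case False
  then obtain l ls where ls: "lfac w = l # ls"
    using lfac(2)[of w] by (cases "lfac w") auto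
  have "lyndon_list (l # ls)"
    using lfac(1)[of w] by (simp add: ls)
  then have lyn: "lyndon l" "lyndon_list ls"
    by (simp_all add: lyndon_list_Cons)
  have w_eq: "w = l @ concat ls"
    using lfac(2)[of w] ls by simp
  have ne: "l \<noteq> []" "concat ls \<noteq> []"
    using lyn(1) w w_eq by (auto simp del: concat_eq_Nil_conv)
  have "lmset w = lmset l + lmset (concat ls)"
    using lyn by (simp add: lmset_def lfac_lyndon lfac_concat ls)
  from stuffle_Sigma[OF this, of q] obtain n where n: "n > 0"
    "stuffle q (Sigma_family q l) (Sigma_family q (concat ls)) = scale (of_nat n) (Sigma_family q w)"
    by blast
  have "pairing (Sigma_family q v) 1 = 0" if "v \<noteq> []" for v
    using pairing_Sigma_Pi[of q v "[]"] that by simp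
  then have "of_nat n * pairing (Sigma_family q w) P = 0"
    using pairing_stuffle_primitive[OF P, of "Sigma_family q l" "Sigma_family q (concat ls)"] ne
    by (simp add: n(2))
  with n(1) show ?thesis
    by (rule of_nat_mult_eq_0)
qed

lemma basis_Pi_primitives: "is_basis {l. lyndon l} (Pi_family q) (primitives q)"
proof (rule is_basisI)
  show "c = 0" if "lincomb (Pi_family q) c = 0" for c
    using unitri_indep[OF unitri_Pi_family that] .
  show "P \<in> primitives q \<longleftrightarrow> (\<exists>c. supp c \<subseteq> {l. lyndon l} \<and> lincomb (Pi_family q) c = P)" for P
  proof
    assume P: "P \<in> primitives q"
    obtain c where c: "lincomb (Pi_family q) c = P"
      using unitri_span[of "Pi_family q"] unitri_Pi_family by blast
    \<comment> \<open>The coefficient at \<open>w\<close> is recovered by pairing with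
      \<open>\<Sigma>_w\<close>.\<close>
    have "lyndon w" if "w \<in> supp c" for w
      using pairing_Sigma_primitive[OF P, of w] pairing_Sigma_lincomb[of q w c] that
      by (auto simp: c in_keys_iff)
    with c show "\<exists>c. supp c \<subseteq> {l. lyndon l} \<and> lincomb (Pi_family q) c = P"
      by blast
  next
    assume "\<exists>c. supp c \<subseteq> {l. lyndon l} \<and> lincomb (Pi_family q) c = P"
    then obtain c where c: "supp c \<subseteq> {l. lyndon l}" "P = lincomb (Pi_family q) c"
      by blast
    show "P \<in> primitives q"
      unfolding c(2) lincomb_def
    proof (rule poly.subspace_sum[OF subspace_primitives])
      fix l
      assume "l \<in> supp c"
      then have "Pi_family q l \<in> primitives q"
        using c(1) by (auto simp: Pi_family_lyndon Pi_lyndon_primitive)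
      then show "scale (coeff c l) (Pi_family q l) \<in> primitives q"
        by (rule poly.subspace_scale[OF subspace_primitives])
    qed
  qed
qed

section \<open>The transcendence basis\<close>

lemma stuffle_subalgebra_hull: "stuffle_subalgebra q (stuffle_subalgebra q hull S)"
  by (rule hull_in) (auto simp: stuffle_subalgebra_def intro: poly.subspace_Inter)

text \<open>Induction over the list of factors: multiplying by one more \<open>\<Sigma>_l\<close>
  yields the next member up to a positive integer, which a scalar divides out inside the
  subalgebra.\<close>

lemma Sigma_in_hull:
  "Sigma_family q w \<in> stuffle_subalgebra q hull (Sigma_family q ` {l. lyndon l})"
    (is "_ \<in> ?H")
proof -
  have H: "poly.subspace ?H" "1 \<in> ?H" "\<And>P Q. P \<in> ?H \<Longrightarrow> Q \<in> ?H \<Longrightarrow> stuffle q P Q \<in> ?H"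
    using stuffle_subalgebra_hull stuffle_subalgebra_def[of q ?H] by blast+
  have "Sigma_family q (concat ls) \<in> ?H" if "lyndon_list ls" for ls
    using that
  proof (induct ls)
    case Nil
    then show ?case
      using H(2) by simp
  next
    case (Cons l ls)
    then have ls: "lyndon l" "lyndon_list ls"
      by (simp_all add: lyndon_list_Cons)
    have "lmset (concat (l # ls)) = lmset l + lmset (concat ls)"
      using ls Cons(2) by (simp only: lmset_concat) (simp add: lmset_def lfac_lyndon)
    from stuffle_Sigma[OF this, of q] obtain n where n: "n > 0"
      "stuffle q (Sigma_family q l) (Sigma_family q (concat ls)) =
        scale (of_nat n) (Sigma_family q (concat (l # ls)))"
      by blast
    have "Sigma_family q l \<in> ?H"
      using ls(1) by (intro hull_inc) simp
    then have "scale (of_nat n) (Sigma_family q (concat (l # ls))) \<in> ?H"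
      unfolding n(2)[symmetric] by (intro H(3) Cons(1) ls(2))
    then have "scale (inverse (of_nat n) *\<^sub>Q 1)
        (scale (of_nat n) (Sigma_family q (concat (l # ls)))) \<in> ?H"
      by (rule poly.subspace_scale[OF H(1)])
    then show ?case
      using of_nat_inverse[OF n(1), where 'k = 'a]
      by (simp only: poly.scale_scale mult.commute[of _ "of_nat n"] poly.scale_one)
  qed
  from this[OF lfac(1)[of w]] show ?thesis
    by (simp add: lfac(2))
qed

lemma stuffle_power_Sigma:
  assumes "lyndon l"
  shows "\<exists>n>0. stuffle_power q (Sigma_family q l) i =
    scale (of_nat n) (Sigma_family q (word_of_lmset (replicate_mset i l)))"
proof (induct i)
  case 0
  then show ?case
    by (intro exI[of _ 1]) (simp add: stuffle_power_def word_of_lmset_def)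
next
  case (Suc i)
  then obtain n where n: "n > 0" "stuffle_power q (Sigma_family q l) i =
      scale (of_nat n) (Sigma_family q (word_of_lmset (replicate_mset i l)))"
    by blast
  have lmset: "lmset (word_of_lmset (replicate_mset j l)) = replicate_mset j l" for j
    using assms by (intro lmset_word_of_lmset) (auto split: if_splits)
  have "lmset (word_of_lmset (replicate_mset (Suc i) l)) =
      lmset l + lmset (word_of_lmset (replicate_mset i l))"
    unfolding lmset using assms by (simp add: lmset_def lfac_lyndon)
  from stuffle_Sigma[OF this, of q] obtain m where m: "m > 0"
    "stuffle q (Sigma_family q l) (Sigma_family q (word_of_lmset (replicate_mset i l))) =
      scale (of_nat m) (Sigma_family q (word_of_lmset (replicate_mset (Suc i) l)))"
    by blast
  have "stuffle_power q (Sigma_family q l) (Suc i) =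
      stuffle q (Sigma_family q l) (stuffle_power q (Sigma_family q l) i)"
    by (simp add: stuffle_power_def)
  with n m show ?case
    by (intro exI[of _ "n * m"]) simp
qed

text \<open>Exponent vectors supported on Lyndon words become the multisets \<open>lmset\<close>, so
  that monomials are indexed by words.\<close>

definition exponent_mset :: "('a \<Rightarrow>\<^sub>0 nat) \<Rightarrow> 'a multiset" where
  "exponent_mset m = (\<Sum>l\<in>supp m. replicate_mset (coeff m l) l)"

lemma count_exponent_mset: "count (exponent_mset m) l = coeff m l"
  by (simp add: exponent_mset_def count_sum in_keys_iff)

lemma stuffle_monomial_Sigma:
  assumes "supp m \<subseteq> {l. lyndon l}"
  shows "\<exists>n>0. stuffle_monomial q (Sigma_family q) m =
    scale (of_nat n) (Sigma_family q (word_of_lmset (exponent_mset m)))"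
proof -
  interpret S: comm_monoid_set "stuffle q" 1
    using comm_monoid_stuffle[of q] by (rule comm_monoid_set.intro)
  have "\<exists>n>0. S.F (\<lambda>l. stuffle_power q (Sigma_family q l) (coeff m l)) A =
      scale (of_nat n) (Sigma_family q (word_of_lmset (\<Sum>l\<in>A. replicate_mset (coeff m l) l)))"
    if "finite A" "A \<subseteq> {l. lyndon l}" for A
    using that
  proof (induct A)
    case empty
    then show ?case
      by (intro exI[of _ 1]) (simp add: word_of_lmset_def)
  next
    case (insert l A)
    let ?M = "\<Sum>l\<in>A. replicate_mset (coeff m l) l" and ?R = "replicate_mset (coeff m l) l"
    obtain n where n: "n > 0" "S.F (\<lambda>l. stuffle_power q (Sigma_family q l) (coeff m l)) A =
        scale (of_nat n) (Sigma_family q (word_of_lmset ?M))"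
      using insert by blast
    obtain n' where n': "n' > 0" "stuffle_power q (Sigma_family q l) (coeff m l) =
        scale (of_nat n') (Sigma_family q (word_of_lmset ?R))"
      using stuffle_power_Sigma[of l q "coeff m l"] insert(4) by auto
    have "\<forall>k\<in>#?M. lyndon k" "\<forall>k\<in>#?R. lyndon k"
      using insert(1,4) by (auto simp: set_mset_sum split: if_splits)
    then have "lmset (word_of_lmset (?R + ?M)) = lmset (word_of_lmset ?R) + lmset (word_of_lmset ?M)"
      by (subst (1 2 3) lmset_word_of_lmset) auto
    from stuffle_Sigma[OF this, of q] obtain k where k: "k > 0"
      "stuffle q (Sigma_family q (word_of_lmset ?R)) (Sigma_family q (word_of_lmset ?M)) =
        scale (of_nat k) (Sigma_family q (word_of_lmset (?R + ?M)))"
      by blast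
    show ?case
      using insert(1,2) n n' k by (intro exI[of _ "n * n' * k"]) (simp add: ac_simps)
  qed
  from this[of "supp m"] assms show ?thesis
    by (simp add: stuffle_monomial_def exponent_mset_def)
qed

lemma stuffle_alg_independent_Sigma:
  fixes q :: "'k::comm_rat_algebra_1"
  shows "stuffle_alg_independent q {l. lyndon l} (Sigma_family q)"
  unfolding stuffle_alg_independent_def
proof (intro allI impI)
  fix p :: "(lword \<Rightarrow>\<^sub>0 nat) \<Rightarrow>\<^sub>0 'k"
  assume p: "(\<forall>m\<in>supp p. supp m \<subseteq> {l. lyndon l}) \<and> stuffle_eval q (Sigma_family q) p = 0"
  let ?w = "\<lambda>m. word_of_lmset (exponent_mset m)"
  have "\<exists>N. \<forall>m\<in>supp p. N m > 0 \<and> stuffle_monomial q (Sigma_family q) m =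
      scale (of_nat (N m)) (Sigma_family q (?w m))"
    using p stuffle_monomial_Sigma[of _ q] by (intro bchoice) blast
  then obtain N where N: "\<And>m. m \<in> supp p \<Longrightarrow> N m > 0"
    "\<And>m. m \<in> supp p \<Longrightarrow> stuffle_monomial q (Sigma_family q) m =
      scale (of_nat (N m)) (Sigma_family q (?w m))"
    by blast
  \<comment> \<open>Distinct monomials belong to distinct words, since a word returns the multiset
    of its factors and thereby the exponents. Hence no two terms of \<open>p\<close> collect at the
    same index.\<close>
  have inj: "inj_on ?w (supp p)"
  proof (rule inj_onI)
    fix m m'
    assume m: "m \<in> supp p" "m' \<in> supp p" "?w m = ?w m'"
    have "l \<in> supp m" if "l \<in># exponent_mset m" for l and m :: "lword \<Rightarrow>\<^sub>0 nat"
      using that by (metis count_eq_zero_iff count_exponent_mset in_keys_iff)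
    then have "lmset (?w m) = exponent_mset m" if "m \<in> supp p" for m
      using that p by (intro lmset_word_of_lmset) blast
    with m have "exponent_mset m = exponent_mset m'"
      by metis
    then show "m = m'"
      by (intro poly_mapping_eqI) (simp flip: count_exponent_mset)
  qed
  define c where "c = (\<Sum>m\<in>supp p. Poly_Mapping.single (?w m) (of_nat (N m) * coeff p m))"
  have "lincomb (Sigma_family q) c = stuffle_eval q (Sigma_family q) p"
    by (simp add: c_def stuffle_eval_def N mult.commute)
  with p have "lincomb (Sigma_family q) c = 0"
    by simp
  then have "c = 0"
    by (rule Sigma_indep)
  have "coeff p m = 0" if m: "m \<in> supp p" for m
  proof -
    have "coeff c (?w m) = (\<Sum>m'\<in>supp p. if m' = m then of_nat (N m) * coeff p m else 0)"
      unfolding c_def lookup_sum using m inj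
      by (intro sum.cong) (auto simp: lookup_single when_def dest: inj_onD)
    also have "\<dots> = of_nat (N m) * coeff p m"
      using m by simp
    finally show ?thesis
      using of_nat_mult_eq_0[OF N(1)[OF m], of "coeff p m"] \<open>c = 0\<close> by simp
  qed
  then show "p = 0"
    by (intro poly_mapping_eqI) (auto simp: in_keys_iff)
qed

theorem theorem1:
  fixes q :: "'k::comm_rat_algebra_1"
  shows "is_basis {l. lyndon l} (Pi_family q) (primitives q) \<and>
         is_basis UNIV (Pi_family q) UNIV \<and>
         is_basis UNIV (Sigma_family q) UNIV \<and>
         stuffle_transcendence_basis q {l. lyndon l} (Sigma_family q)"
proof -
  let ?H = "stuffle_subalgebra q hull (Sigma_family q ` {l. lyndon l})"
  have "poly.subspace ?H"
    using stuffle_subalgebra_hull stuffle_subalgebra_def[of q ?H] by blast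
  then have "lincomb (Sigma_family q) c \<in> ?H" for c
    unfolding lincomb_def
    by (intro poly.subspace_sum poly.subspace_scale Sigma_in_hull)
  then have "?H = UNIV"
    using Sigma_span[of q] by (metis UNIV_eq_I)
  then show ?thesis
    unfolding stuffle_transcendence_basis_def
    by (intro conjI basis_Pi_primitives basis_Pi basis_Sigma stuffle_alg_independent_Sigma)
qed

end
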